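(* Let $\alpha_t\equiv\alpha$, $\beta_t\equiv\beta$ be constant with $0<\kappa<1$, where $\kappa:=1-\alpha/\beta$. (1) (Location.) In an equilibrium, if such exists, in which $\pi=1$ on $[0,\theta)$ and $\pi=0$ on $[\theta,1]$, the uniquely optimal switching time $\theta$ solves the first-order condition $$1=\theta+\frac{\kappa^{-1}-1}{\lambda h(\theta)},\qquad\text{equivalently}\qquad (1-\theta)h(\theta)=\frac{\kappa^{-1}-1}{\lambda}.$$ For given $\lambda$ this equation is solvable for large enough $\kappa$, in fact if and only if $1>\kappa\ge[1+\lambda h(0)]^{-1}$. (2) (Existence.) Such an equilibrium exists if and only if the unique switching time $\theta$ (the solution of the equation in (1)) satisfies $$(1-\theta)h(\theta)\cdot\frac{-\log\big(h(\theta)/h(0)\big)}{g(\theta)}>\kappa^{-1}-1\qquad\text{and}\qquad \frac{-\log\big(h(\theta)/h(0)\big)}{g(\theta)}>\lambda .$$ (3) In such an equilibrium the unique switching time $\theta=\theta(\lambda)$, as a function of $\lambda$, satisfies $$\theta'(\lambda)=\frac{(1-\theta)h(\theta)}{\lambda[h(\theta)-(1-\theta)h'(\theta)]}>0 .$$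
   Context: Fix $\sigma>0$ and $\lambda>0$. Let $\Phi$ be the standard normal distribution function, and for $t\in[0,1]$ put $h(t)=2\Phi(\sigma(1-t)/2)-1$ and $g(t)=\int_0^t h(u)\,\mathrm{d}u$. Constants $0<\alpha<\beta$ are given. A control is a right-continuous function with left limits $\pi:[0,1]\to[0,1]$ ($\pi_t=0$: candid; $\pi_t=1$: sparing). The corresponding state (valuation) $\gamma_t$ solves $\gamma_t'=-\lambda\pi_t h(t)\gamma_t$, $\gamma_0=1$; write $\gamma^1_t=e^{-\lambda g(t)}$ for the state when $\pi\equiv1$. The aim is to maximize over controls the objective $\int_0^1(1-\pi_t)\,\beta\,[\gamma^1_t-\kappa\gamma_t]\,\mathrm{d}t$. The co-state $\mu_t$ associated with $\pi$ is the continuous, piecewise smooth solution of $\mu_t'=\beta\kappa(1-\pi_t)+\lambda\pi_t h(t)\mu_t$, $\mu_1=0$, and the switching curve is $\gamma^*_t=\gamma^1_t/(\kappa-\lambda h(t)\mu_t/\beta)$. An equilibrium is a control $\pi$ which, together with its state and co-state, satisfies the (Pontryagin) optimality rule: $\pi_t=1$ if $\gamma_t\ge\gamma^*_t$ and $\pi_t=0$ if $\gamma_t<\gamma^*_t$, at every continuity point $t$ of $\pi$ (i.e. away from switching times).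
   Formalization: In (2), existence is shown equivalent to the inequalities with ≥; the strict ones are equivalent to existence of an equilibrium whose state meets the switching curve only at θ (the strict claim fails at equality). Equilibria are taken with θ>0, since (1) fails at θ=0 for small κ. *)

theory Defs
  imports "HOL-Probability.Probability"
begin

definition Phi :: "real \<Rightarrow> real" where
  "Phi x = cdf std_normal_distribution x"

definition h :: "real \<Rightarrow> real \<Rightarrow> real" where
  "h \<sigma> t = 2 * Phi (\<sigma> * (1 - t) / 2) - 1"

definition g :: "real \<Rightarrow> real \<Rightarrow> real" where
  "g \<sigma> t = integral {0..t} (h \<sigma>)"

definition is_control :: "(real \<Rightarrow> real) \<Rightarrow> bool" where
  "is_control \<pi> \<longleftrightarrow>
     (\<forall>t\<in>{0..1}. \<pi> t \<in> {0..1}) \<and>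
     (\<forall>t\<in>{0..<1}. continuous (at_right t) \<pi>) \<and>
     (\<forall>t\<in>{0<..1}. \<exists>l. (\<pi> \<longlongrightarrow> l) (at_left t))"

abbreviation continuity_point :: "(real \<Rightarrow> real) \<Rightarrow> real \<Rightarrow> bool" where
  "continuity_point \<pi> t \<equiv> t \<in> {0..1} \<and> continuous (at t within {0..1}) \<pi>"

text \<open>A control may jump, so the differential equations are imposed at its continuity points.
  A control has at most countably many jumps, so together with continuity of the solution this is
  the integral form of the equation.\<close>

definition is_state :: "real \<Rightarrow> real \<Rightarrow> (real \<Rightarrow> real) \<Rightarrow> (real \<Rightarrow> real) \<Rightarrow> bool" where
  "is_state \<sigma> lam \<pi> \<gamma> \<longleftrightarrow>
     continuous_on {0..1} \<gamma> \<and> \<gamma> 0 = 1 \<and>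
     (\<forall>t. continuity_point \<pi> t \<longrightarrow>
        (\<gamma> has_real_derivative - lam * \<pi> t * h \<sigma> t * \<gamma> t) (at t within {0..1}))"

text \<open>The state when \<open>\<pi>\<close> is identically 1.\<close>

definition gamma1 :: "real \<Rightarrow> real \<Rightarrow> real \<Rightarrow> real" where
  "gamma1 \<sigma> lam t = exp (- lam * g \<sigma> t)"

definition objective ::
  "real \<Rightarrow> real \<Rightarrow> real \<Rightarrow> real \<Rightarrow> (real \<Rightarrow> real) \<Rightarrow> (real \<Rightarrow> real) \<Rightarrow> real" where
  "objective \<sigma> lam \<beta> \<kappa> \<pi> \<gamma> =
     integral {0..1} (\<lambda>t. (1 - \<pi> t) * \<beta> * (gamma1 \<sigma> lam t - \<kappa> * \<gamma> t))"

definition is_costate ::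
  "real \<Rightarrow> real \<Rightarrow> real \<Rightarrow> real \<Rightarrow> (real \<Rightarrow> real) \<Rightarrow> (real \<Rightarrow> real) \<Rightarrow> bool" where
  "is_costate \<sigma> lam \<beta> \<kappa> \<pi> \<mu> \<longleftrightarrow>
     continuous_on {0..1} \<mu> \<and> \<mu> piecewise_C1_differentiable_on {0..1} \<and> \<mu> 1 = 0 \<and>
     (\<forall>t. continuity_point \<pi> t \<longrightarrow>
        (\<mu> has_real_derivative \<beta> * \<kappa> * (1 - \<pi> t) + lam * \<pi> t * h \<sigma> t * \<mu> t)
          (at t within {0..1}))"

definition switching_curve ::
  "real \<Rightarrow> real \<Rightarrow> real \<Rightarrow> real \<Rightarrow> (real \<Rightarrow> real) \<Rightarrow> real \<Rightarrow> real" where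
  "switching_curve \<sigma> lam \<beta> \<kappa> \<mu> t = gamma1 \<sigma> lam t / (\<kappa> - lam * h \<sigma> t * \<mu> t / \<beta>)"

definition is_equilibrium ::
  "real \<Rightarrow> real \<Rightarrow> real \<Rightarrow> real \<Rightarrow> (real \<Rightarrow> real) \<Rightarrow> (real \<Rightarrow> real) \<Rightarrow> (real \<Rightarrow> real) \<Rightarrow> bool" where
  "is_equilibrium \<sigma> lam \<beta> \<kappa> \<pi> \<gamma> \<mu> \<longleftrightarrow>
     is_control \<pi> \<and> is_state \<sigma> lam \<pi> \<gamma> \<and> is_costate \<sigma> lam \<beta> \<kappa> \<pi> \<mu> \<and>
     (\<forall>t. continuity_point \<pi> t \<longrightarrow>
        (\<gamma> t \<ge> switching_curve \<sigma> lam \<beta> \<kappa> \<mu> t \<longrightarrow> \<pi> t = 1) \<and>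
        (\<gamma> t < switching_curve \<sigma> lam \<beta> \<kappa> \<mu> t \<longrightarrow> \<pi> t = 0))"

definition sparing_then_candid :: "(real \<Rightarrow> real) \<Rightarrow> real \<Rightarrow> bool" where
  "sparing_then_candid \<pi> \<theta> \<longleftrightarrow> (\<forall>t\<in>{0..<\<theta>}. \<pi> t = 1) \<and> (\<forall>t\<in>{\<theta>..1}. \<pi> t = 0)"

text \<open>\<open>0 < \<theta>\<close>: for \<open>\<theta> = 0\<close> the control is identically 0 and there is no switch.  That
  control is an equilibrium whenever \<open>\<kappa>\<close> is small enough, but then no \<open>\<theta>\<close> solves the first-order
  condition.\<close>

definition switching_equilibrium ::
  "real \<Rightarrow> real \<Rightarrow> real \<Rightarrow> real \<Rightarrow> real \<Rightarrow> (real \<Rightarrow> real) \<Rightarrow> (real \<Rightarrow> real) \<Rightarrow> (real \<Rightarrow> real) \<Rightarrow> bool"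
  where
  "switching_equilibrium \<sigma> lam \<beta> \<kappa> \<theta> \<pi> \<gamma> \<mu> \<longleftrightarrow>
     0 < \<theta> \<and> \<theta> \<le> 1 \<and> sparing_then_candid \<pi> \<theta> \<and> is_equilibrium \<sigma> lam \<beta> \<kappa> \<pi> \<gamma> \<mu>"

text \<open>For a switching equilibrium these times are just \<open>\<theta>\<close>, except in the borderline case
  \<open>h \<sigma> 0 = h \<sigma> \<theta> * exp (lam * g \<sigma> \<theta>)\<close>, where the state also touches the curve at time 0; the
  optimality rule admits that case because it prescribes \<open>\<pi> t = 1\<close> on the curve.\<close>

definition switching_times ::
  "real \<Rightarrow> real \<Rightarrow> real \<Rightarrow> real \<Rightarrow> (real \<Rightarrow> real) \<Rightarrow> (real \<Rightarrow> real) \<Rightarrow> real set" where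
  "switching_times \<sigma> lam \<beta> \<kappa> \<gamma> \<mu> =
     {t \<in> {0..1}. \<gamma> t = switching_curve \<sigma> lam \<beta> \<kappa> \<mu> t}"

text \<open>\<open>\<theta> = 1\<close> has to be excluded explicitly: \<open>h \<sigma> 1 = 0\<close>, so the quotient would be 0 there and
  \<open>\<theta> = 1\<close> a spurious solution.\<close>

definition first_order_condition :: "real \<Rightarrow> real \<Rightarrow> real \<Rightarrow> real \<Rightarrow> bool" where
  "first_order_condition \<sigma> lam \<kappa> \<theta> \<longleftrightarrow>
     0 \<le> \<theta> \<and> \<theta> < 1 \<and> 1 = \<theta> + (1 / \<kappa> - 1) / (lam * h \<sigma> \<theta>)"

definition switching_time :: "real \<Rightarrow> real \<Rightarrow> real \<Rightarrow> real" where
  "switching_time \<sigma> \<kappa> lam = (THE \<theta>. first_order_condition \<sigma> lam \<kappa> \<theta>)"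

end

theory Submission
  imports Defs
begin

text \<open>For a control that is sparing before \<open>\<theta>\<close> and candid afterwards, state and co-state are
  explicit, and with \<open>s(t) = (1 - t) h(t)\<close> the state divided by the switching curve equals
  \<open>\<kappa> (1 + \<lambda> s(t)) exp (\<lambda> (g(t) - g(\<theta>)))\<close> after \<open>\<theta>\<close>.  The optimality rule forces this
  quotient to be 1 at \<open>\<theta>\<close>, which is the first-order condition; given that, the quotient equals
  \<open>1 + (1 - \<kappa>) (exp (\<psi>(t) - \<psi>(\<theta>)) - 1)\<close> before \<open>\<theta>\<close>, where \<open>\<psi> = log h + \<lambda> g\<close>.  Since \<open>h\<close> is
  positive, decreasing and concave, \<open>\<psi>\<close> is strictly concave, so the rule holds before \<open>\<theta>\<close> iff
  \<open>\<psi>(0) \<ge> \<psi>(\<theta>)\<close>, which is the existence criterion.  It then holds after \<open>\<theta>\<close> as well, because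
  the logarithm of the quotient has derivative \<open>\<lambda> s \<psi>' / (1 + \<lambda> s)\<close> there and \<open>\<psi>' < 0\<close>.

  As a function of the switching time \<open>t\<close> the payoff has a derivative with the sign of
  \<open>\<kappa> (1 + \<lambda> s(t)) - 1\<close>, which changes once, from plus to minus, because \<open>s\<close> is strictly
  decreasing.  Solving the first-order condition for \<open>\<lambda>\<close> exhibits \<open>\<lambda> \<mapsto> \<theta>(\<lambda>)\<close> as the inverse of
  \<open>t \<mapsto> (1 / \<kappa> - 1) / s(t)\<close>.\<close>

section \<open>The function h\<close>

lemma Phi_diff:
  assumes "a < b"
  shows "Phi b - Phi a = integral {a..b} std_normal_density"
proof -
  interpret prob_space std_normal_distribution
    by (rule prob_space_normal_density) simp
  interpret finite_borel_measure std_normal_distribution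
    by unfold_locales auto
  have "Phi b - Phi a = measure std_normal_distribution {a<..b}"
    unfolding Phi_def by (rule cdf_diff_eq[OF assms])
  also have "\<dots> = (LINT x|std_normal_distribution. indicator {a<..b} x)"
    by simp
  also have "\<dots> = (LINT x:{a<..b}|lborel. std_normal_density x)"
    unfolding set_lebesgue_integral_def by (subst integral_density) (auto simp: mult.commute)
  also have "\<dots> = integral {a<..b} std_normal_density"
    by (intro set_borel_integral_eq_integral)
      (simp add: set_integrable_def mult.commute integrable_real_mult_indicator)
  \<comment> \<open>The half-open interval that comes with distribution functions is closed up at
    the cost of one null point, so that the fundamental theorem of calculus can be used
    later.\<close>
  also have "\<dots> = integral {a..b} std_normal_density"
    by (intro integral_spike_set; rule negligible_subset[of "{a}"]) auto
  finally show ?thesis .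
qed

text \<open>Near \<open>x\<close>, \<open>Phi\<close> is the constant \<open>Phi (x - 1)\<close>
  plus an indefinite integral of the continuous density. The base point \<open>x - 1\<close> is an
  arbitrary point to the left of \<open>x\<close>.\<close>

lemma Phi_has_derivative: "(Phi has_real_derivative std_normal_density x) (at x)"
proof -
  have "((\<lambda>y. Phi (x - 1) + integral {x - 1..y} std_normal_density)
      has_real_derivative 0 + std_normal_density x) (at x within {x - 1..x + 1})"
    by (intro DERIV_add DERIV_const integral_has_real_derivative)
      (auto simp: std_normal_density_def[abs_def] intro!: continuous_intros)
  then have "((\<lambda>y. Phi (x - 1) + integral {x - 1..y} std_normal_density)
      has_real_derivative std_normal_density x) (at x)"
    by (simp add: at_within_Icc_at)
  then show ?thesis
  proof (rule has_field_derivative_transform_within_open)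
    show "open {x - 1<..<x + 1}" "x \<in> {x - 1<..<x + 1}" by auto
    show "Phi (x - 1) + integral {x - 1..y} std_normal_density = Phi y"
      if "y \<in> {x - 1<..<x + 1}" for y
      using Phi_diff[of "x - 1" y] that by simp
  qed
qed

text \<open>The density is even, so both half-lines carry the same mass, and the total mass is
  1.\<close>

lemma Phi_0: "Phi 0 = 1 / 2"
proof -
  have int: "integrable lborel (\<lambda>x. std_normal_density x * indicator A x)"
    if "A \<in> sets borel" for A
    using that by (intro integrable_real_mult_indicator integrable_normal_density) auto
  have "Phi 0 = (LINT x|std_normal_distribution. indicator {..0} x)"
    by (simp add: Phi_def cdf_def)
  also have "\<dots> = (LINT x|lborel. std_normal_density x * indicator {..0} x)"
    by (subst integral_density) auto
  finally have left: "Phi 0 = (LINT x|lborel. std_normal_density x * indicator {..0} x)" .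
  \<comment> \<open>Reflection of the line at 0.\<close>
  also have "\<dots> = (LINT x|lborel. std_normal_density (- x) * indicator {..0} (- x))"
    using lborel_integral_real_affine[of "- 1" "\<lambda>x. std_normal_density x * indicator {..0} x" 0]
    by simp
  also have "\<dots> = (LINT x|lborel. std_normal_density x * indicator {0..} x)"
    by (intro Bochner_Integration.integral_cong) (auto simp: std_normal_density_def indicator_def)
  finally have right: "Phi 0 = (LINT x|lborel. std_normal_density x * indicator {0..} x)" .
  have "Phi 0 + Phi 0 = (LINT x|lborel. std_normal_density x * indicator {..0} x
      + std_normal_density x * indicator {0..} x)"
    by (subst Bochner_Integration.integral_add) (auto simp: left[symmetric] right[symmetric] int)
  \<comment> \<open>The two indicators overlap in the null set \<open>{0}\<close> only.\<close>
  also have "\<dots> = (LINT x|lborel. std_normal_density x)"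
    using AE_lborel_singleton[of "0::real"]
    by (intro integral_cong_AE) (auto simp: indicator_def elim!: eventually_mono)
  also have "\<dots> = 1"
    by (simp add: integral_normal_density)
  finally show ?thesis by simp
qed

section \<open>Sign, monotonicity and concavity of \<open>h\<close>\<close>

definition h_deriv :: "real \<Rightarrow> real \<Rightarrow> real" where
  "h_deriv \<sigma> t = - \<sigma> * std_normal_density (\<sigma> * (1 - t) / 2)"

lemma h_has_h_deriv: "(h \<sigma> has_real_derivative h_deriv \<sigma> t) (at t)"
proof -
  have "((\<lambda>t. \<sigma> * (1 - t) / 2) has_real_derivative - \<sigma> / 2) (at t)"
    by (auto intro!: derivative_eq_intros)
  then have "((\<lambda>t. Phi (\<sigma> * (1 - t) / 2)) has_real_derivative
      std_normal_density (\<sigma> * (1 - t) / 2) * (- \<sigma> / 2)) (at t)"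
    by (rule DERIV_chain2[OF Phi_has_derivative])
  from DERIV_diff[OF DERIV_cmult[OF this, of 2] DERIV_const[of 1]]
  show ?thesis
    by (simp add: h_def[abs_def] h_deriv_def algebra_simps)
qed

lemma h_1: "h \<sigma> 1 = 0"
  by (simp add: h_def Phi_0)

lemma h_deriv_neg: "\<sigma> > 0 \<Longrightarrow> h_deriv \<sigma> t < 0"
  by (simp add: h_deriv_def normal_density_pos)

text \<open>This is the strict concavity of \<open>h\<close> up to time 1: the argument of the
  density is nonnegative there and moves towards 0, where the density peaks. Beyond 1 it moves away
  from 0 again, hence the bound on \<open>u\<close>.\<close>

lemma h_deriv_strict_antimono:
  assumes "\<sigma> > 0" "t < u" "u \<le> 1"
  shows "h_deriv \<sigma> u < h_deriv \<sigma> t"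
proof -
  have "(\<sigma> * (1 - u) / 2)\<^sup>2 < (\<sigma> * (1 - t) / 2)\<^sup>2"
    using assms by (intro power_strict_mono) auto
  then have "std_normal_density (\<sigma> * (1 - t) / 2) < std_normal_density (\<sigma> * (1 - u) / 2)"
    by (simp add: std_normal_density_def divide_strict_right_mono)
  with assms(1) show ?thesis
    by (simp add: h_deriv_def)
qed

lemma h_strict_antimono:
  assumes "\<sigma> > 0" "t < u"
  shows "h \<sigma> u < h \<sigma> t"
  by (rule DERIV_neg_imp_decreasing[OF assms(2)]) (use assms h_has_h_deriv h_deriv_neg in blast)

lemma h_pos: "\<sigma> > 0 \<Longrightarrow> t < 1 \<Longrightarrow> h \<sigma> t > 0"
  using h_strict_antimono[of \<sigma> t 1] by (simp add: h_1)

lemma h_nonneg: "\<sigma> > 0 \<Longrightarrow> t \<le> 1 \<Longrightarrow> h \<sigma> t \<ge> 0"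
  using h_pos[of \<sigma> t] by (cases "t = 1") (auto simp: h_1)

lemma continuous_on_h: "continuous_on S (h \<sigma>)"
  by (rule DERIV_continuous_on[OF has_field_derivative_at_within[OF h_has_h_deriv]])

section \<open>The antiderivative \<open>g\<close>\<close>

lemma g_has_derivative_within:
  "t \<in> {0..1} \<Longrightarrow> (g \<sigma> has_real_derivative h \<sigma> t) (at t within {0..1})"
  unfolding g_def[abs_def] by (rule integral_has_real_derivative[OF continuous_on_h])

text \<open>Two-sided derivatives are taken at interior points only: \<open>g\<close> is constantly
  0 for negative times, so it usually has a kink at 0.\<close>

lemma g_has_derivative: "0 < t \<Longrightarrow> t < 1 \<Longrightarrow> (g \<sigma> has_real_derivative h \<sigma> t) (at t)"
  using g_has_derivative_within[of t \<sigma>] by (simp add: at_within_Icc_at)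

lemma continuous_on_g: "continuous_on {0..1} (g \<sigma>)"
  by (rule DERIV_continuous_on[OF g_has_derivative_within])

lemma g_0: "g \<sigma> 0 = 0"
  by (simp add: g_def)

lemma g_pos:
  assumes "\<sigma> > 0" "0 < t" "t \<le> 1"
  shows "g \<sigma> t > 0"
proof -
  have "g \<sigma> 0 < g \<sigma> t"
  proof (rule DERIV_pos_imp_increasing_open[OF assms(2)])
    show "\<exists>y. (g \<sigma> has_real_derivative y) (at x) \<and> 0 < y" if "0 < x" "x < t" for x
      using g_has_derivative[of x \<sigma>] h_pos[of \<sigma> x] assms that by auto
    show "continuous_on {0..t} (g \<sigma>)"
      using continuous_on_subset[OF continuous_on_g] assms by auto
  qed
  then show ?thesis by (simp add: g_0)
qed

section \<open>Concavity and the first-order condition\<close>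

definition scaled_h :: "real \<Rightarrow> real \<Rightarrow> real" where
  "scaled_h \<sigma> t = (1 - t) * h \<sigma> t"

lemma scaled_h_has_derivative:
  "(scaled_h \<sigma> has_real_derivative - (h \<sigma> t - (1 - t) * h_deriv \<sigma> t)) (at t)"
  unfolding scaled_h_def[abs_def]
  by (rule derivative_eq_intros h_has_h_deriv refl | simp)+

lemma continuous_on_scaled_h: "continuous_on S (scaled_h \<sigma>)"
  by (rule DERIV_continuous_on[OF has_field_derivative_at_within[OF scaled_h_has_derivative]])

text \<open>The factors are decreased one at a time. Replacing \<open>1 - u\<close> by
  \<open>1 - t\<close> gives only a weak inequality, since \<open>h \<sigma> u\<close> may vanish;
  the strict one comes from \<open>h\<close>, as \<open>1 - t\<close> is positive.\<close>

lemma scaled_h_strict_antimono: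
  assumes "\<sigma> > 0" "t < u" "u \<le> 1"
  shows "scaled_h \<sigma> u < scaled_h \<sigma> t"
proof -
  have "scaled_h \<sigma> u \<le> (1 - t) * h \<sigma> u"
    using assms h_nonneg[of \<sigma> u] by (auto simp: scaled_h_def intro: mult_right_mono)
  also have "\<dots> < scaled_h \<sigma> t"
    using assms h_strict_antimono[of \<sigma> t u] by (auto simp: scaled_h_def)
  finally show ?thesis .
qed

lemma scaled_h_pos: "\<sigma> > 0 \<Longrightarrow> t < 1 \<Longrightarrow> scaled_h \<sigma> t > 0"
  by (simp add: scaled_h_def h_pos)

text \<open>The exponential of \<open>psi\<close> is
  \<open>h \<sigma> t * exp (lam * g \<sigma> t)\<close>, the part of the state-to-curve quotient
  that varies before the switch.\<close>

definition psi :: "real \<Rightarrow> real \<Rightarrow> real \<Rightarrow> real" where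
  "psi \<sigma> lam t = ln (h \<sigma> t) + lam * g \<sigma> t"

definition psi_deriv :: "real \<Rightarrow> real \<Rightarrow> real \<Rightarrow> real" where
  "psi_deriv \<sigma> lam t = h_deriv \<sigma> t / h \<sigma> t + lam * h \<sigma> t"

lemma psi_has_derivative:
  assumes "\<sigma> > 0" "0 < t" "t < 1"
  shows "(psi \<sigma> lam has_real_derivative psi_deriv \<sigma> lam t) (at t)"
  unfolding psi_def[abs_def] psi_deriv_def
  by (rule derivative_eq_intros h_has_h_deriv g_has_derivative assms h_pos refl | simp)+

lemma continuous_on_psi: "\<sigma> > 0 \<Longrightarrow> continuous_on {0..<1} (psi \<sigma> lam)"
  unfolding psi_def[abs_def]
  by (intro continuous_intros continuous_on_h continuous_on_subset[OF continuous_on_g])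
    (auto dest: h_pos[of \<sigma>])

text \<open>This is the strict concavity of \<open>psi\<close>: \<open>lam * h\<close> decreases,
  and so does \<open>h_deriv / h\<close>, whose negative numerator decreases while its positive
  denominator shrinks.\<close>

lemma psi_deriv_strict_antimono:
  assumes "\<sigma> > 0" "lam > 0" "t < u" "u < 1"
  shows "psi_deriv \<sigma> lam u < psi_deriv \<sigma> lam t"
proof -
  have pos: "0 < h \<sigma> u" "h \<sigma> u < h \<sigma> t"
    using assms h_pos h_strict_antimono by auto
  have "- h_deriv \<sigma> t / h \<sigma> t \<le> - h_deriv \<sigma> t / h \<sigma> u"
    using pos h_deriv_neg[OF assms(1), of t] by (intro divide_left_mono) auto
  also have "\<dots> < - h_deriv \<sigma> u / h \<sigma> u"
    using pos h_deriv_strict_antimono[of \<sigma> t u] assms by (intro divide_strict_right_mono) auto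
  finally have "h_deriv \<sigma> u / h \<sigma> u < h_deriv \<sigma> t / h \<sigma> t" by simp
  moreover have "lam * h \<sigma> u < lam * h \<sigma> t"
    using pos assms by simp
  ultimately show ?thesis
    by (simp add: psi_deriv_def)
qed

lemma psi_MVT:
  assumes "\<sigma> > 0" "0 \<le> a" "a < b" "b < 1"
  obtains z where "a < z" "z < b" "psi \<sigma> lam b - psi \<sigma> lam a = (b - a) * psi_deriv \<sigma> lam z"
proof -
  have der: "(psi \<sigma> lam has_real_derivative psi_deriv \<sigma> lam x) (at x)" if "a < x" "x < b" for x
    using that assms by (intro psi_has_derivative) auto
  have "\<exists>l z. a < z \<and> z < b \<and> (psi \<sigma> lam has_real_derivative l) (at z) \<and>
      psi \<sigma> lam b - psi \<sigma> lam a = (b - a) * l"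
    using assms der real_differentiable_def
    by (intro MVT continuous_on_subset[OF continuous_on_psi[OF assms(1)]]) auto
  then show ?thesis
    using that der DERIV_unique by blast
qed

text \<open>Since \<open>psi\<close> does not gain between 0 and \<theta>, the mean value theorem
  gives a nonpositive slope in between, and strict concavity makes all later slopes
  negative.\<close>

lemma psi_deriv_neg_from:
  assumes "\<sigma> > 0" "lam > 0" "0 < \<theta>" "\<theta> \<le> t" "t < 1"
    and "psi \<sigma> lam \<theta> \<le> psi \<sigma> lam 0"
  shows "psi_deriv \<sigma> lam t < 0"
proof -
  obtain z where z: "0 < z" "z < \<theta>" "psi \<sigma> lam \<theta> - psi \<sigma> lam 0 = (\<theta> - 0) * psi_deriv \<sigma> lam z"
    using psi_MVT[of \<sigma> 0 \<theta> lam] assms by auto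
  then have "psi_deriv \<sigma> lam z \<le> 0"
    using assms by (smt (verit) mult_pos_pos)
  then show ?thesis
    using psi_deriv_strict_antimono[of \<sigma> lam z t] z assms by linarith
qed

text \<open>Otherwise \<open>psi\<close> would not rise from 0 to \<open>t\<close> and not fall from
  \<open>t\<close> to \<theta>, so a nonpositive slope would precede a nonnegative one, against
  strict concavity.\<close>

lemma psi_greater_before:
  assumes "\<sigma> > 0" "lam > 0" "0 < t" "t < \<theta>" "\<theta> < 1"
    and "psi \<sigma> lam \<theta> \<le> psi \<sigma> lam 0"
  shows "psi \<sigma> lam \<theta> < psi \<sigma> lam t"
proof (rule ccontr)
  assume neg: "\<not> ?thesis"
  obtain y where y: "0 < y" "y < t" "psi \<sigma> lam t - psi \<sigma> lam 0 = (t - 0) * psi_deriv \<sigma> lam y"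
    using psi_MVT[of \<sigma> 0 t lam] assms by auto
  then have "psi_deriv \<sigma> lam y \<le> 0"
    using neg assms by (smt (verit) mult_pos_pos)
  obtain z where z: "t < z" "z < \<theta>" "psi \<sigma> lam \<theta> - psi \<sigma> lam t = (\<theta> - t) * psi_deriv \<sigma> lam z"
    using psi_MVT[of \<sigma> t \<theta> lam] assms by auto
  then have "0 \<le> psi_deriv \<sigma> lam z"
    using neg assms by (smt (verit) mult_pos_neg)
  then show False
    using psi_deriv_strict_antimono[of \<sigma> lam y z] \<open>psi_deriv \<sigma> lam y \<le> 0\<close> y z assms by linarith
qed

text \<open>Up to the common summand \<open>ln \<kappa> - lam * g \<sigma> \<theta>\<close>, both
  sides are logarithms of the state-to-curve quotient in the candid phase. The end
  \<open>t = 1\<close> is included although \<open>psi_deriv\<close> is controlled only before it: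
  derivatives are needed at interior points only, and \<open>1 + lam * scaled_h\<close> stays
  positive.\<close>

lemma candid_curve_bound:
  assumes "\<sigma> > 0" "lam > 0" "0 < \<theta>" "\<theta> < t" "t \<le> 1"
    and "psi \<sigma> lam \<theta> \<le> psi \<sigma> lam 0"
  shows "ln (1 + lam * scaled_h \<sigma> t) + lam * g \<sigma> t < ln (1 + lam * scaled_h \<sigma> \<theta>) + lam * g \<sigma> \<theta>"
proof (rule DERIV_neg_imp_decreasing_open[OF \<open>\<theta> < t\<close>])
  have pos: "1 + lam * scaled_h \<sigma> x > 0" if "x \<le> 1" for x
    using that assms h_nonneg[of \<sigma> x] by (simp add: scaled_h_def add_pos_nonneg)
  show "\<exists>y. ((\<lambda>x. ln (1 + lam * scaled_h \<sigma> x) + lam * g \<sigma> x) has_real_derivative y) (at x) \<and> y < 0"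
    if x: "\<theta> < x" "x < t" for x
  proof (intro exI conjI)
    have "((\<lambda>x. 1 + lam * scaled_h \<sigma> x) has_real_derivative
        0 + lam * - (h \<sigma> x - (1 - x) * h_deriv \<sigma> x)) (at x)"
      by (intro DERIV_add DERIV_const DERIV_cmult scaled_h_has_derivative)
    from DERIV_chain2[OF DERIV_ln_divide this] pos[of x] x assms(5)
    have "((\<lambda>x. ln (1 + lam * scaled_h \<sigma> x)) has_real_derivative
        1 / (1 + lam * scaled_h \<sigma> x) * (0 + lam * - (h \<sigma> x - (1 - x) * h_deriv \<sigma> x))) (at x)"
      by simp
    then show "((\<lambda>x. ln (1 + lam * scaled_h \<sigma> x) + lam * g \<sigma> x) has_real_derivative
        1 / (1 + lam * scaled_h \<sigma> x) * (0 + lam * - (h \<sigma> x - (1 - x) * h_deriv \<sigma> x))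
          + lam * h \<sigma> x) (at x)"
      using x assms by (intro DERIV_add DERIV_cmult g_has_derivative) auto
    have h: "h \<sigma> x > 0"
      using x assms by (intro h_pos) auto
    have "1 / (1 + lam * scaled_h \<sigma> x) * (0 + lam * - (h \<sigma> x - (1 - x) * h_deriv \<sigma> x)) + lam * h \<sigma> x
        = lam * scaled_h \<sigma> x * psi_deriv \<sigma> lam x / (1 + lam * scaled_h \<sigma> x)"
    proof -
      \<comment> \<open>The factor \<open>h\<close> inside \<open>scaled_h\<close> cancels the
        denominator in \<open>psi_deriv\<close>.\<close>
      have "scaled_h \<sigma> x * psi_deriv \<sigma> lam x = (1 - x) * h_deriv \<sigma> x + lam * h \<sigma> x * scaled_h \<sigma> x"
        using h by (simp add: psi_deriv_def scaled_h_def field_simps)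
      from arg_cong[OF this, of "(*) lam"]
      have "lam * scaled_h \<sigma> x * psi_deriv \<sigma> lam x =
          lam * - (h \<sigma> x - (1 - x) * h_deriv \<sigma> x) + lam * h \<sigma> x * (1 + lam * scaled_h \<sigma> x)"
        by (simp add: algebra_simps)
      then show ?thesis
        using pos[of x] x assms(5) by (simp add: add_divide_distrib)
    qed
    also have "\<dots> < 0"
      using pos[of x] x assms scaled_h_pos[of \<sigma> x] psi_deriv_neg_from[of \<sigma> lam \<theta> x]
      by (intro divide_neg_pos mult_pos_neg mult_pos_pos) auto
    finally show "1 / (1 + lam * scaled_h \<sigma> x) * (0 + lam * - (h \<sigma> x - (1 - x) * h_deriv \<sigma> x))
        + lam * h \<sigma> x < 0" .
  qed
  show "continuous_on {\<theta>..t} (\<lambda>x. ln (1 + lam * scaled_h \<sigma> x) + lam * g \<sigma> x)"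
  proof -
    have "\<forall>x\<in>{\<theta>..t}. 1 + lam * scaled_h \<sigma> x \<noteq> 0"
      using pos assms(5) by (metis atLeastAtMost_iff less_irrefl order_trans)
    moreover have "{\<theta>..t} \<subseteq> {0..1}"
      using assms by auto
    ultimately show ?thesis
      by (intro continuous_intros continuous_on_scaled_h continuous_on_subset[OF continuous_on_g])
  qed
qed

section \<open>Solutions of the first-order condition\<close>

lemma first_order_condition_iff:
  assumes "\<sigma> > 0" "lam > 0"
  shows "first_order_condition \<sigma> lam k \<theta> \<longleftrightarrow>
    0 \<le> \<theta> \<and> \<theta> < 1 \<and> scaled_h \<sigma> \<theta> = (1 / k - 1) / lam"
proof (cases "\<theta> < 1")
  case True
  have "lam * h \<sigma> \<theta> > 0"
    using assms h_pos[OF assms(1) True] by simp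
  then have "1 = \<theta> + (1 / k - 1) / (lam * h \<sigma> \<theta>) \<longleftrightarrow> (1 - \<theta>) * (lam * h \<sigma> \<theta>) = 1 / k - 1"
    by (smt (verit) eq_divide_eq)
  also have "\<dots> \<longleftrightarrow> scaled_h \<sigma> \<theta> = (1 / k - 1) / lam"
    using assms by (simp add: scaled_h_def eq_divide_eq mult_ac)
  finally show ?thesis
    by (simp add: first_order_condition_def)
qed (simp add: first_order_condition_def)

lemma first_order_condition_unique:
  assumes "\<sigma> > 0" "lam > 0"
    and "first_order_condition \<sigma> lam k \<theta>" "first_order_condition \<sigma> lam k \<theta>'"
  shows "\<theta> = \<theta>'"
  using assms scaled_h_strict_antimono[of \<sigma> \<theta> \<theta>'] scaled_h_strict_antimono[of \<sigma> \<theta>' \<theta>]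
  by (auto simp: first_order_condition_iff) (metis less_eq_real_def less_irrefl linorder_neqE_linordered_idom)

text \<open>On times from 0 up to but excluding 1, \<open>scaled_h\<close> decreases continuously
  from \<open>h \<sigma> 0\<close> towards 0, so it takes exactly the positive values up to
  \<open>h \<sigma> 0\<close>. The two bounds on \<open>k\<close> say that the prescribed value is
  one of these.\<close>

lemma first_order_condition_solvable_iff:
  assumes "\<sigma> > 0" "lam > 0" "k > 0"
  shows "(\<exists>\<theta>. first_order_condition \<sigma> lam k \<theta>) \<longleftrightarrow> 1 > k \<and> k \<ge> 1 / (1 + lam * h \<sigma> 0)"
proof -
  have h0: "h \<sigma> 0 > 0"
    using assms by (simp add: h_pos)
  have "(\<exists>\<theta>. first_order_condition \<sigma> lam k \<theta>) \<longleftrightarrow>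
      0 < (1 / k - 1) / lam \<and> (1 / k - 1) / lam \<le> scaled_h \<sigma> 0" (is "?L \<longleftrightarrow> ?R")
  proof
    assume ?L
    then obtain \<theta> where "0 \<le> \<theta>" "\<theta> < 1" and eq: "scaled_h \<sigma> \<theta> = (1 / k - 1) / lam"
      using assms by (auto simp: first_order_condition_iff)
    moreover from this have "scaled_h \<sigma> \<theta> \<le> scaled_h \<sigma> 0"
      using scaled_h_strict_antimono[of \<sigma> 0 \<theta>] assms by (cases "\<theta> = 0") auto
    ultimately show ?R
      using scaled_h_pos[OF assms(1)] unfolding eq[symmetric] by auto
  next
    assume R: ?R
    have "\<exists>\<theta>\<ge>0. \<theta> \<le> 1 \<and> scaled_h \<sigma> \<theta> = (1 / k - 1) / lam"
      using R by (intro IVT2' continuous_on_scaled_h) (auto simp: scaled_h_def)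
    then obtain \<theta> where "0 \<le> \<theta>" "\<theta> \<le> 1" "scaled_h \<sigma> \<theta> = (1 / k - 1) / lam"
      by blast
    \<comment> \<open>\<open>scaled_h\<close> vanishes at 1, while the prescribed value is
      positive.\<close>
    moreover from this R have "\<theta> \<noteq> 1"
      by (auto simp: scaled_h_def)
    ultimately show ?L
      using assms by (auto simp: first_order_condition_iff intro!: exI[of _ \<theta>])
  qed
  also have "0 < (1 / k - 1) / lam \<longleftrightarrow> k < 1"
    using assms by (simp add: zero_less_divide_iff)
  also have "(1 / k - 1) / lam \<le> scaled_h \<sigma> 0 \<longleftrightarrow> 1 \<le> k * (1 + lam * h \<sigma> 0)"
    using assms by (simp add: scaled_h_def field_simps)
  also have "\<dots> \<longleftrightarrow> 1 / (1 + lam * h \<sigma> 0) \<le> k"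
    using assms h0 by (simp add: divide_le_eq add_pos_pos)
  finally show ?thesis .
qed

section \<open>The switching time as a function of \<open>lam\<close>\<close>

lemma switching_time_eq:
  "\<sigma> > 0 \<Longrightarrow> lam > 0 \<Longrightarrow> first_order_condition \<sigma> lam k \<theta> \<Longrightarrow> switching_time \<sigma> k lam = \<theta>"
  unfolding switching_time_def by (rule the_equality) (auto intro: first_order_condition_unique)

text \<open>The inverse function theorem is applied to \<open>c / scaled_h \<sigma> t\<close>, the
  rate for which \<open>t\<close> satisfies the first-order condition. Uniqueness of solutions makes
  \<open>switching_time\<close> its left inverse on the open unit interval.\<close>

lemma switching_time_has_derivative:
  assumes "\<sigma> > 0" "lam > 0" "0 < k" "k < 1"
    and foc: "first_order_condition \<sigma> lam k \<theta>" and "0 < \<theta>"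
  defines "D \<equiv> (1 - \<theta>) * h \<sigma> \<theta> / (lam * (h \<sigma> \<theta> - (1 - \<theta>) * deriv (h \<sigma>) \<theta>))"
  shows "(switching_time \<sigma> k has_real_derivative D) (at lam)" "D > 0"
proof -
  define c where "c = 1 / k - 1"
  have c: "c > 0"
    using assms by (simp add: c_def)
  have th: "\<theta> < 1" "scaled_h \<sigma> \<theta> = c / lam"
    using assms by (auto simp: first_order_condition_iff c_def)
  have lam: "lam = c / scaled_h \<sigma> \<theta>"
    using th c assms by simp
  have deriv: "deriv (h \<sigma>) \<theta> = h_deriv \<sigma> \<theta>"
    by (rule DERIV_imp_deriv[OF h_has_h_deriv])
  define E where "E = h \<sigma> \<theta> - (1 - \<theta>) * h_deriv \<sigma> \<theta>"
  have "(1 - \<theta>) * h_deriv \<sigma> \<theta> < 0"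
    using th h_deriv_neg[OF assms(1)] by (simp add: mult_pos_neg)
  then have E: "E > 0"
    using h_pos[OF assms(1) th(1)] by (simp add: E_def)
  have q: "scaled_h \<sigma> \<theta> > 0"
    using scaled_h_pos[OF assms(1) th(1)] .
  have D: "D = scaled_h \<sigma> \<theta> / (lam * E)"
    by (simp add: D_def E_def deriv scaled_h_def)
  show "D > 0"
    using D q E assms by simp
  have "((\<lambda>t. c / scaled_h \<sigma> t) has_real_derivative
      (0 * scaled_h \<sigma> \<theta> - c * - E) / (scaled_h \<sigma> \<theta> * scaled_h \<sigma> \<theta>)) (at \<theta>)"
    unfolding E_def using q by (intro DERIV_divide DERIV_const scaled_h_has_derivative) auto
  \<comment> \<open>One factor of the denominator is absorbed by
    \<open>lam = c / scaled_h \<sigma> \<theta>\<close>, which leaves the reciprocal of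
    \<open>D\<close>.\<close>
  also have "(0 * scaled_h \<sigma> \<theta> - c * - E) / (scaled_h \<sigma> \<theta> * scaled_h \<sigma> \<theta>) = lam * E / scaled_h \<sigma> \<theta>"
    using lam by simp
  finally have der: "((\<lambda>t. c / scaled_h \<sigma> t) has_real_derivative lam * E / scaled_h \<sigma> \<theta>) (at \<theta>)" .
  have "(switching_time \<sigma> k has_real_derivative D) (at (c / scaled_h \<sigma> \<theta>))"
    unfolding has_field_derivative_def
  proof (rule has_derivative_inverse_strong[where f = "\<lambda>t. c / scaled_h \<sigma> t" and x = \<theta>])
    show "open {0<..<1::real}" "\<theta> \<in> {0<..<1}"
      using th assms by auto
    show "((\<lambda>t. c / scaled_h \<sigma> t) has_derivative (*) (lam * E / scaled_h \<sigma> \<theta>)) (at \<theta>)"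
      using der by (simp add: has_field_derivative_def)
    show "(*) (lam * E / scaled_h \<sigma> \<theta>) \<circ> (*) D = id"
      using q E assms(2) by (auto simp: D fun_eq_iff)
    show "continuous_on {0<..<1} (\<lambda>t. c / scaled_h \<sigma> t)"
      using scaled_h_pos[OF assms(1)] by (intro continuous_intros continuous_on_scaled_h) force
    show "switching_time \<sigma> k (c / scaled_h \<sigma> z) = z" if "z \<in> {0<..<1}" for z
      using that c assms(1) scaled_h_pos[OF assms(1), of z]
      by (intro switching_time_eq) (auto simp: first_order_condition_iff c_def)
  qed
  then show "(switching_time \<sigma> k has_real_derivative D) (at lam)"
    by (simp flip: lam)
qed

section \<open>State and co-state of a switching control\<close>

lemma continuity_point_sparing_then_candid:
  assumes "sparing_then_candid \<pi> s" "t \<in> {0..1}" "t \<noteq> s"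
  shows "continuity_point \<pi> t"
proof -
  have "eventually (\<lambda>x. \<pi> x = \<pi> t) (at t within {0..1})"
  proof (cases "t < s")
    case True
    then have "eventually (\<lambda>x. x < s) (at t within {0..1})"
      by (rule order_tendstoD(2)[OF tendsto_ident_at])
    moreover have "eventually (\<lambda>x. x \<in> {0..1}) (at t within {0..1})"
      by (simp add: eventually_at_filter)
    ultimately show ?thesis
      by eventually_elim (use assms True in \<open>simp add: sparing_then_candid_def\<close>)
  next
    case False
    with assms have "s < t" by simp
    then have "eventually (\<lambda>x. s < x) (at t within {0..1})"
      by (rule order_tendstoD(1)[OF tendsto_ident_at])
    moreover have "eventually (\<lambda>x. x \<in> {0..1}) (at t within {0..1})"
      by (simp add: eventually_at_filter)
    ultimately show ?thesis
      by eventually_elim (use assms \<open>s < t\<close> in \<open>simp add: sparing_then_candid_def\<close>)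
  qed
  then show ?thesis
    using assms by (simp add: continuous_within tendsto_eventually)
qed

lemma not_continuity_point_switch:
  assumes "sparing_then_candid \<pi> s" "0 < s" "s \<le> 1"
  shows "\<not> continuity_point \<pi> s"
proof
  assume "continuity_point \<pi> s"
  then obtain d where "d > 0" and d: "\<And>x. x \<in> {0..1} \<Longrightarrow> dist x s < d \<Longrightarrow> dist (\<pi> x) (\<pi> s) < 1"
    using zero_less_one unfolding continuous_within_eps_delta by metis
  \<comment> \<open>A point just before the jump; \<open>max\<close> keeps it in the unit interval,
    and \<open>0 < s\<close> keeps it before \<open>s\<close>.\<close>
  define x where "x = max 0 (s - d / 2)"
  have x: "0 \<le> x" "x < s" "dist x s < d"
    using assms \<open>d > 0\<close> by (auto simp: x_def dist_real_def)
  then have "\<pi> x = 1" "\<pi> s = 0"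
    using assms by (auto simp: sparing_then_candid_def)
  with d[of x] x assms show False
    by simp
qed

section \<open>Explicit state and co-state\<close>

definition switch_state :: "real \<Rightarrow> real \<Rightarrow> real \<Rightarrow> real \<Rightarrow> real" where
  "switch_state \<sigma> lam \<theta> t = exp (- lam * g \<sigma> (min t \<theta>))"

text \<open>Solved backwards from the terminal value 0: linear with slope
  \<open>\<beta> * \<kappa>\<close> after \<theta>, and a solution of the homogeneous equation
  before. \<open>max\<close> and \<open>min\<close> glue the two branches into one visibly
  continuous formula.\<close>

definition switch_costate :: "real \<Rightarrow> real \<Rightarrow> real \<Rightarrow> real \<Rightarrow> real \<Rightarrow> real \<Rightarrow> real" where
  "switch_costate \<sigma> lam \<beta> \<kappa> \<theta> t =
     - \<beta> * \<kappa> * (1 - max t \<theta>) * exp (lam * (g \<sigma> (min t \<theta>) - g \<sigma> \<theta>))"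

definition switch_control :: "real \<Rightarrow> real \<Rightarrow> real" where
  "switch_control \<theta> t = (if t < \<theta> then 1 else 0)"

lemma sparing_then_candid_switch_control: "sparing_then_candid (switch_control \<theta>) \<theta>"
  by (simp add: sparing_then_candid_def switch_control_def)

lemma is_control_switch_control: "is_control (switch_control \<theta>)"
proof -
  have ev_right: "eventually (\<lambda>x. switch_control \<theta> x = switch_control \<theta> t) (at_right t)" for t
  proof (cases "t < \<theta>")
    case True
    then have "eventually (\<lambda>x. x < \<theta>) (at_right t)"
      by (rule order_tendstoD(2)[OF tendsto_ident_at])
    then show ?thesis
      by eventually_elim (use True in \<open>simp add: switch_control_def\<close>)
  next
    case False
    have "eventually (\<lambda>x. t < x) (at_right t)"
      by (rule eventually_at_right_less)
    then show ?thesis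
      by eventually_elim (use False in \<open>simp add: switch_control_def\<close>)
  qed
  \<comment> \<open>The left limit at \<theta> is 1, although the control is already 0 there; hence
    \<open>t \<le> \<theta>\<close> in place of \<open>t < \<theta>\<close>.\<close>
  have ev_left: "eventually (\<lambda>x. switch_control \<theta> x = (if t \<le> \<theta> then 1 else 0)) (at_left t)" for t
  proof (cases "t \<le> \<theta>")
    case True
    have "eventually (\<lambda>x. x < t) (at_left t)"
      by (simp add: eventually_at_filter)
    then show ?thesis
      by eventually_elim (use True in \<open>simp add: switch_control_def\<close>)
  next
    case False
    then have "eventually (\<lambda>x. \<theta> < x) (at_left t)"
      by (intro order_tendstoD(1)[OF tendsto_ident_at]) simp
    then show ?thesis
      by eventually_elim (use False in \<open>simp add: switch_control_def\<close>)
  qed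
  show ?thesis
    unfolding is_control_def continuous_within
    using tendsto_eventually[OF ev_right] tendsto_eventually[OF ev_left]
    by (auto simp: switch_control_def[abs_def] split: if_splits)
qed

text \<open>Away from \<theta> the state agrees locally with one branch, exponential or constant, on
  a neighbourhood whose radius is the distance to \<theta>.\<close>

lemma is_state_switch_state:
  assumes "0 < \<theta>" "\<theta> < 1"
  shows "is_state \<sigma> lam (switch_control \<theta>) (switch_state \<sigma> lam \<theta>)"
  unfolding is_state_def
proof (intro conjI allI impI)
  show "continuous_on {0..1} (switch_state \<sigma> lam \<theta>)"
    unfolding switch_state_def[abs_def] using assms
    by (intro continuous_intros continuous_on_compose2[OF continuous_on_g]) auto
  show "switch_state \<sigma> lam \<theta> 0 = 1"
    using assms by (simp add: switch_state_def g_0)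
  fix t assume t: "continuity_point (switch_control \<theta>) t"
  then have "t \<noteq> \<theta>"
    using not_continuity_point_switch[OF sparing_then_candid_switch_control] assms by auto
  then consider "t < \<theta>" | "\<theta> < t" by linarith
  then show "(switch_state \<sigma> lam \<theta> has_real_derivative
      - lam * switch_control \<theta> t * h \<sigma> t * switch_state \<sigma> lam \<theta> t) (at t within {0..1})"
  proof cases
    case 1
    have "((\<lambda>t. exp (- lam * g \<sigma> t)) has_real_derivative
        - lam * switch_control \<theta> t * h \<sigma> t * switch_state \<sigma> lam \<theta> t) (at t within {0..1})"
      using 1 t
      by (auto intro!: derivative_eq_intros g_has_derivative_within
          simp: switch_control_def switch_state_def)
    then show ?thesis
      by (rule has_field_derivative_transform_within[of _ _ _ _ "\<theta> - t"])
        (use 1 t in \<open>auto simp: switch_state_def dist_real_def min_def\<close>)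
  next
    case 2
    have "((\<lambda>t. exp (- lam * g \<sigma> \<theta>)) has_real_derivative
        - lam * switch_control \<theta> t * h \<sigma> t * switch_state \<sigma> lam \<theta> t) (at t within {0..1})"
      using 2 by (simp add: switch_control_def)
    then show ?thesis
      by (rule has_field_derivative_transform_within[of _ _ _ _ "t - \<theta>"])
        (use 2 t in \<open>auto simp: switch_state_def dist_real_def min_def\<close>)
  qed
qed

lemma continuous_on_switch_costate:
  assumes "0 < \<theta>" "\<theta> < 1"
  shows "continuous_on {0..1} (switch_costate \<sigma> lam \<beta> \<kappa> \<theta>)"
  unfolding switch_costate_def[abs_def] using assms
  by (intro continuous_intros continuous_on_compose2[OF continuous_on_g]) auto

lemma switch_costate_has_derivative:
  assumes "0 < \<theta>" "\<theta> < 1" "t \<in> {0..1}" "t \<noteq> \<theta>"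
  shows "(switch_costate \<sigma> lam \<beta> \<kappa> \<theta> has_real_derivative
      \<beta> * \<kappa> * (1 - switch_control \<theta> t)
        + lam * switch_control \<theta> t * h \<sigma> t * switch_costate \<sigma> lam \<beta> \<kappa> \<theta> t) (at t within {0..1})"
proof (cases "t < \<theta>")
  case True
  have "((\<lambda>t. - \<beta> * \<kappa> * (1 - \<theta>) * exp (lam * (g \<sigma> t - g \<sigma> \<theta>))) has_real_derivative
      \<beta> * \<kappa> * (1 - switch_control \<theta> t)
        + lam * switch_control \<theta> t * h \<sigma> t * switch_costate \<sigma> lam \<beta> \<kappa> \<theta> t) (at t within {0..1})"
    using True assms
    by (auto intro!: derivative_eq_intros g_has_derivative_within
        simp: switch_control_def switch_costate_def)
  then show ?thesis
    by (rule has_field_derivative_transform_within[of _ _ _ _ "\<theta> - t"])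
      (use True assms in \<open>auto simp: switch_costate_def dist_real_def min_def max_def\<close>)
next
  case False
  have "((\<lambda>t. - \<beta> * \<kappa> * (1 - t)) has_real_derivative
      \<beta> * \<kappa> * (1 - switch_control \<theta> t)
        + lam * switch_control \<theta> t * h \<sigma> t * switch_costate \<sigma> lam \<beta> \<kappa> \<theta> t) (at t within {0..1})"
    using False by (auto intro!: derivative_eq_intros simp: switch_control_def)
  then show ?thesis
    by (rule has_field_derivative_transform_within[of _ _ _ _ "t - \<theta>"])
      (use False assms in \<open>auto simp: switch_costate_def dist_real_def min_def max_def\<close>)
qed

lemma is_costate_switch_costate:
  assumes "0 < \<theta>" "\<theta> < 1"
  shows "is_costate \<sigma> lam \<beta> \<kappa> (switch_control \<theta>) (switch_costate \<sigma> lam \<beta> \<kappa> \<theta>)"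
  unfolding is_costate_def
proof (intro conjI allI impI)
  show cont: "continuous_on {0..1} (switch_costate \<sigma> lam \<beta> \<kappa> \<theta>)"
    by (rule continuous_on_switch_costate[OF assms])
  show "switch_costate \<sigma> lam \<beta> \<kappa> \<theta> 1 = 0"
    using assms by (simp add: switch_costate_def)
  define D where "D t = \<beta> * \<kappa> * (1 - switch_control \<theta> t)
        + lam * switch_control \<theta> t * h \<sigma> t * switch_costate \<sigma> lam \<beta> \<kappa> \<theta> t" for t
  \<comment> \<open>The kink at \<theta> is removed, and the endpoints as well, so that derivatives
    within the unit interval become two-sided.\<close>
  have "switch_costate \<sigma> lam \<beta> \<kappa> \<theta> C1_differentiable_on ({0..1} - {0, \<theta>, 1})"
    unfolding C1_differentiable_on_def
  proof (intro exI[of _ D] conjI ballI)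
    fix t assume t: "t \<in> {0..1} - {0, \<theta>, 1}"
    with switch_costate_has_derivative[OF assms, of t \<sigma> lam \<beta> \<kappa>]
    show "(switch_costate \<sigma> lam \<beta> \<kappa> \<theta> has_vector_derivative D t) (at t)"
      by (auto simp: D_def at_within_Icc_at simp flip: has_real_derivative_iff_has_vector_derivative)
  next
    have split: "{0..1} - {0, \<theta>, 1} = {0<..<\<theta>} \<union> {\<theta><..<1}"
      using assms by auto
    have "continuous_on {0<..<\<theta>} (\<lambda>t. lam * h \<sigma> t * switch_costate \<sigma> lam \<beta> \<kappa> \<theta> t)"
      using assms
      by (intro continuous_intros continuous_on_h continuous_on_subset[OF cont]) auto
    then have "continuous_on {0<..<\<theta>} D"
      by (rule continuous_on_eq) (simp add: D_def switch_control_def)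
    moreover have "continuous_on {\<theta><..<1} D"
      by (rule continuous_on_eq[OF continuous_on_const[of _ "\<beta> * \<kappa>"]])
        (simp add: D_def switch_control_def)
    ultimately show "continuous_on ({0..1} - {0, \<theta>, 1}) D"
      unfolding split by (intro continuous_on_open_Un) auto
  qed
  then show "switch_costate \<sigma> lam \<beta> \<kappa> \<theta> piecewise_C1_differentiable_on {0..1}"
    unfolding piecewise_C1_differentiable_on_def using cont
    by (intro conjI exI[of _ "{0, \<theta>, 1}"]) auto
  fix t assume t: "continuity_point (switch_control \<theta>) t"
  then have "t \<noteq> \<theta>"
    using not_continuity_point_switch[OF sparing_then_candid_switch_control] assms by auto
  with t show "(switch_costate \<sigma> lam \<beta> \<kappa> \<theta> has_real_derivative
      \<beta> * \<kappa> * (1 - switch_control \<theta> t)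
        + lam * switch_control \<theta> t * h \<sigma> t * switch_costate \<sigma> lam \<beta> \<kappa> \<theta> t) (at t within {0..1})"
    by (intro switch_costate_has_derivative assms) auto
qed

section \<open>Uniqueness of state and co-state\<close>

lemma state_eq_switch_state:
  assumes state: "is_state \<sigma> lam \<pi> \<gamma>" and ctrl: "sparing_then_candid \<pi> s"
    and "s \<in> {0..1}" "t \<in> {0..1}"
  shows "\<gamma> t = switch_state \<sigma> lam s t"
proof -
  have cont: "continuous_on {0..1} \<gamma>" and "\<gamma> 0 = 1"
    using state by (auto simp: is_state_def)
  have der: "(\<gamma> has_real_derivative - lam * \<pi> x * h \<sigma> x * \<gamma> x) (at x)"
    if "0 < x" "x < 1" "x \<noteq> s" for x
  proof -
    have "(\<gamma> has_real_derivative - lam * \<pi> x * h \<sigma> x * \<gamma> x) (at x within {0..1})"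
      using state continuity_point_sparing_then_candid[OF ctrl, of x] that
      by (auto simp: is_state_def)
    then show ?thesis
      using that by (simp add: at_within_Icc_at)
  qed
  have before: "\<gamma> x = exp (- lam * g \<sigma> x)" if x: "0 \<le> x" "x \<le> s" for x
  proof (cases "s = 0")
    \<comment> \<open>A switch at time 0 is covered because it competes in the payoff
      comparison.\<close>
    case True
    with x show ?thesis by (simp add: g_0 \<open>\<gamma> 0 = 1\<close>)
  next
    case False
    \<comment> \<open>\<open>exp (lam * g)\<close> is the integrating factor of the linear equation
      in the sparing phase.\<close>
    have "\<gamma> x * exp (lam * g \<sigma> x) = \<gamma> 0 * exp (lam * g \<sigma> 0)"
    proof (rule DERIV_isconst2[of 0 s])
      show "continuous_on {0..s} (\<lambda>x. \<gamma> x * exp (lam * g \<sigma> x))"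
        using assms(3)
        by (intro continuous_intros continuous_on_subset[OF cont]
            continuous_on_subset[OF continuous_on_g]) auto
      fix y assume y: "0 < y" "y < s"
      with ctrl have "\<pi> y = 1"
        by (auto simp: sparing_then_candid_def)
      with y assms(3) show "((\<lambda>x. \<gamma> x * exp (lam * g \<sigma> x)) has_real_derivative 0) (at y)"
        by (auto intro!: derivative_eq_intros der g_has_derivative)
    qed (use False assms x in auto)
    then show ?thesis
      by (simp add: g_0 \<open>\<gamma> 0 = 1\<close> exp_minus field_simps)
  qed
  show ?thesis
  proof (cases "t \<le> s")
    case True
    then show ?thesis
      using before[of t] assms by (simp add: switch_state_def)
  next
    case False
    have "\<gamma> t = \<gamma> s"
    proof (rule DERIV_isconst2[of s 1])
      show "continuous_on {s..1} \<gamma>"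
        using assms by (intro continuous_on_subset[OF cont]) auto
      show "(\<gamma> has_real_derivative 0) (at y)" if "s < y" "y < 1" for y
        using der[of y] ctrl that assms by (auto simp: sparing_then_candid_def)
    qed (use False assms in auto)
    then show ?thesis
      using before[of s] False assms by (simp add: switch_state_def)
  qed
qed

text \<open>The boundary value sits at time 1, so the candid phase is solved first; its value at
  \<open>s\<close> then fixes the constant that the integrating factor
  \<open>exp (- lam * g)\<close> yields in the sparing phase.\<close>

lemma costate_eq_switch_costate:
  assumes costate: "is_costate \<sigma> lam \<beta> \<kappa> \<pi> \<mu>" and ctrl: "sparing_then_candid \<pi> s"
    and "s \<in> {0<..1}" "t \<in> {0..1}"
  shows "\<mu> t = switch_costate \<sigma> lam \<beta> \<kappa> s t"
proof -
  have cont: "continuous_on {0..1} \<mu>" and "\<mu> 1 = 0"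
    using costate by (auto simp: is_costate_def)
  have der: "(\<mu> has_real_derivative \<beta> * \<kappa> * (1 - \<pi> x) + lam * \<pi> x * h \<sigma> x * \<mu> x) (at x)"
    if "0 < x" "x < 1" "x \<noteq> s" for x
  proof -
    have "(\<mu> has_real_derivative \<beta> * \<kappa> * (1 - \<pi> x) + lam * \<pi> x * h \<sigma> x * \<mu> x)
        (at x within {0..1})"
      using costate continuity_point_sparing_then_candid[OF ctrl, of x] that
      by (auto simp: is_costate_def)
    then show ?thesis
      using that by (simp add: at_within_Icc_at)
  qed
  have after: "\<mu> x = - \<beta> * \<kappa> * (1 - x)" if x: "s \<le> x" "x \<le> 1" for x
  proof (cases "s = 1")
    case True
    with x show ?thesis by (simp add: \<open>\<mu> 1 = 0\<close>)
  next
    case False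
    have const: "\<mu> y - \<beta> * \<kappa> * y = \<mu> s - \<beta> * \<kappa> * s" if "s \<le> y" "y \<le> 1" for y
    proof (rule DERIV_isconst2[of s 1])
      show "continuous_on {s..1} (\<lambda>x. \<mu> x - \<beta> * \<kappa> * x)"
        using assms by (intro continuous_intros continuous_on_subset[OF cont]) auto
      fix y assume y: "s < y" "y < 1"
      with ctrl assms have "\<pi> y = 0"
        by (auto simp: sparing_then_candid_def)
      with y assms der[of y] show "((\<lambda>x. \<mu> x - \<beta> * \<kappa> * x) has_real_derivative 0) (at y)"
        by (auto intro!: derivative_eq_intros)
    qed (use False assms that in auto)
    from const[of x] const[of 1] x show ?thesis
      by (simp add: \<open>\<mu> 1 = 0\<close> algebra_simps)
  qed
  show ?thesis
  proof (cases "s \<le> t")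
    case True
    then show ?thesis
      using after[of t] assms by (simp add: switch_costate_def)
  next
    case False
    have const: "\<mu> x * exp (- lam * g \<sigma> x) = \<mu> 0 * exp (- lam * g \<sigma> 0)"
      if x: "0 \<le> x" "x \<le> s" for x
    proof (rule DERIV_isconst2[of 0 s])
      show "continuous_on {0..s} (\<lambda>x. \<mu> x * exp (- lam * g \<sigma> x))"
        using assms(3)
        by (intro continuous_intros continuous_on_subset[OF cont]
            continuous_on_subset[OF continuous_on_g]) auto
      fix y assume y: "0 < y" "y < s"
      with ctrl have "\<pi> y = 1"
        by (auto simp: sparing_then_candid_def)
      with y assms(3) show "((\<lambda>x. \<mu> x * exp (- lam * g \<sigma> x)) has_real_derivative 0) (at y)"
        by (auto intro!: derivative_eq_intros der g_has_derivative)
    qed (use assms x in auto)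
    have "\<mu> t * exp (- lam * g \<sigma> t) = \<mu> s * exp (- lam * g \<sigma> s)"
      using const[of t] const[of s] False assms by simp
    then have "\<mu> t = \<mu> s * exp (lam * (g \<sigma> t - g \<sigma> s))"
      by (simp add: exp_minus exp_diff right_diff_distrib field_simps)
    then show ?thesis
      using after[of s] False assms by (simp add: switch_costate_def)
  qed
qed

section \<open>The optimality rule\<close>

text \<open>\<open>switch_ratio\<close> is the quotient \<open>\<gamma>\<^sub>t / \<gamma>\<^sup>*\<^sub>t\<close> for the control that switches at \<open>\<theta>\<close>.\<close>

definition switch_ratio :: "real \<Rightarrow> real \<Rightarrow> real \<Rightarrow> real \<Rightarrow> real \<Rightarrow> real" where
  "switch_ratio \<sigma> lam \<kappa> \<theta> t =
     \<kappa> * (1 + lam * h \<sigma> t * (1 - max t \<theta>) * exp (lam * (g \<sigma> (min t \<theta>) - g \<sigma> \<theta>)))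
       * exp (lam * (g \<sigma> t - g \<sigma> (min t \<theta>)))"

lemma switch_ratio_pos:
  assumes "\<sigma> > 0" "lam > 0" "\<kappa> > 0" "\<theta> \<le> 1" "t \<le> 1"
  shows "switch_ratio \<sigma> lam \<kappa> \<theta> t > 0"
  using assms h_nonneg[of \<sigma> t] by (auto simp: switch_ratio_def intro!: mult_pos_pos add_pos_nonneg)

text \<open>The factor \<beta> of the co-state cancels, so the denominator of the curve is the first
  factor of \<open>switch_ratio\<close>. The second factor turns \<open>gamma1\<close> into the
  state, which stops decaying at \<theta>.\<close>

lemma switching_curve_eq:
  assumes "\<sigma> > 0" "lam > 0" "\<beta> > 0" "\<kappa> > 0" "\<theta> \<le> 1" "t \<le> 1"
    and "\<mu> t = switch_costate \<sigma> lam \<beta> \<kappa> \<theta> t"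
  shows "switching_curve \<sigma> lam \<beta> \<kappa> \<mu> t = switch_state \<sigma> lam \<theta> t / switch_ratio \<sigma> lam \<kappa> \<theta> t"
proof -
  define A where
    "A = \<kappa> * (1 + lam * h \<sigma> t * (1 - max t \<theta>) * exp (lam * (g \<sigma> (min t \<theta>) - g \<sigma> \<theta>)))"
  have "\<kappa> - lam * h \<sigma> t * \<mu> t / \<beta> = A"
  proof -
    have "lam * h \<sigma> t * \<mu> t / \<beta>
        = lam * h \<sigma> t * (- \<kappa> * (1 - max t \<theta>) * exp (lam * (g \<sigma> (min t \<theta>) - g \<sigma> \<theta>)))"
      using assms(3) by (simp add: assms(7) switch_costate_def)
    then show ?thesis
      unfolding A_def by (simp add: algebra_simps)
  qed
  moreover have "switch_state \<sigma> lam \<theta> t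
      = gamma1 \<sigma> lam t * exp (lam * (g \<sigma> t - g \<sigma> (min t \<theta>)))"
    by (simp add: switch_state_def gamma1_def algebra_simps flip: exp_add)
  moreover have "switch_ratio \<sigma> lam \<kappa> \<theta> t = A * exp (lam * (g \<sigma> t - g \<sigma> (min t \<theta>)))"
    by (simp add: switch_ratio_def A_def)
  ultimately show ?thesis
    by (simp add: switching_curve_def)
qed

lemma switching_curve_compare:
  assumes "\<sigma> > 0" "lam > 0" "\<beta> > 0" "\<kappa> > 0" "\<theta> \<le> 1" "t \<le> 1"
    and "\<gamma> t = switch_state \<sigma> lam \<theta> t" "\<mu> t = switch_costate \<sigma> lam \<beta> \<kappa> \<theta> t"
  shows "switching_curve \<sigma> lam \<beta> \<kappa> \<mu> t \<le> \<gamma> t \<longleftrightarrow> 1 \<le> switch_ratio \<sigma> lam \<kappa> \<theta> t"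
    and "\<gamma> t = switching_curve \<sigma> lam \<beta> \<kappa> \<mu> t \<longleftrightarrow> switch_ratio \<sigma> lam \<kappa> \<theta> t = 1"
proof -
  have "switch_state \<sigma> lam \<theta> t > 0"
    by (simp add: switch_state_def)
  moreover have "switch_ratio \<sigma> lam \<kappa> \<theta> t > 0"
    using assms by (intro switch_ratio_pos)
  moreover have "(S / R \<le> S \<longleftrightarrow> 1 \<le> R) \<and> (S = S / R \<longleftrightarrow> R = 1)" if "S > 0" "R > 0" for S R :: real
    using that by (simp add: pos_divide_le_eq eq_divide_eq)
  moreover note switching_curve_eq[of \<sigma> lam \<beta> \<kappa> \<theta> t \<mu>, OF assms(1-6,8)]
  ultimately show "switching_curve \<sigma> lam \<beta> \<kappa> \<mu> t \<le> \<gamma> t \<longleftrightarrow> 1 \<le> switch_ratio \<sigma> lam \<kappa> \<theta> t"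
    and "\<gamma> t = switching_curve \<sigma> lam \<beta> \<kappa> \<mu> t \<longleftrightarrow> switch_ratio \<sigma> lam \<kappa> \<theta> t = 1"
    by (auto simp: assms(7))
qed

lemma switch_ratio_sparing:
  assumes "\<sigma> > 0" "lam > 0" "\<kappa> > 0" "first_order_condition \<sigma> lam \<kappa> \<theta>" "t \<le> \<theta>"
  shows "switch_ratio \<sigma> lam \<kappa> \<theta> t = 1 + (1 - \<kappa>) * (exp (psi \<sigma> lam t - psi \<sigma> lam \<theta>) - 1)"
proof -
  have th: "\<theta> < 1" "lam * scaled_h \<sigma> \<theta> = 1 / \<kappa> - 1"
    using assms by (auto simp: first_order_condition_iff)
  have pos: "h \<sigma> t > 0" "h \<sigma> \<theta> > 0"
    using assms th by (auto intro: h_pos)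
  have "exp (psi \<sigma> lam t - psi \<sigma> lam \<theta>)
      = exp (ln (h \<sigma> t)) / exp (ln (h \<sigma> \<theta>)) * exp (lam * (g \<sigma> t - g \<sigma> \<theta>))"
    unfolding exp_diff[symmetric] exp_add[symmetric] by (simp add: psi_def algebra_simps)
  also have "\<dots> = h \<sigma> t / h \<sigma> \<theta> * exp (lam * (g \<sigma> t - g \<sigma> \<theta>))"
    using pos by simp
  finally have E: "h \<sigma> t * exp (lam * (g \<sigma> t - g \<sigma> \<theta>)) = h \<sigma> \<theta> * exp (psi \<sigma> lam t - psi \<sigma> lam \<theta>)"
    using pos by simp
  have "switch_ratio \<sigma> lam \<kappa> \<theta> t
      = \<kappa> * (1 + lam * (1 - \<theta>) * (h \<sigma> t * exp (lam * (g \<sigma> t - g \<sigma> \<theta>))))"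
    using assms by (simp add: switch_ratio_def min_absorb1 max_absorb2 mult_ac)
  also have "\<dots> = \<kappa> * (1 + lam * scaled_h \<sigma> \<theta> * exp (psi \<sigma> lam t - psi \<sigma> lam \<theta>))"
    unfolding E by (simp add: scaled_h_def mult_ac)
  \<comment> \<open>By the first-order condition the coefficient of the exponential is
    \<open>\<kappa> * (1 / \<kappa> - 1) = 1 - \<kappa>\<close>.\<close>
  also have "\<dots> = 1 + (1 - \<kappa>) * (exp (psi \<sigma> lam t - psi \<sigma> lam \<theta>) - 1)"
    using assms unfolding th(2) by (simp add: field_simps)
  finally show ?thesis .
qed

lemma switch_ratio_candid:
  assumes "\<theta> \<le> t"
  shows "switch_ratio \<sigma> lam \<kappa> \<theta> t = \<kappa> * (1 + lam * scaled_h \<sigma> t) * exp (lam * (g \<sigma> t - g \<sigma> \<theta>))"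
  using assms by (simp add: switch_ratio_def scaled_h_def min_absorb2 max_absorb1 mult_ac)

text \<open>After taking logarithms this is \<open>candid_curve_bound\<close>, where the first-order
  condition turns \<open>1 + lam * scaled_h \<sigma> \<theta>\<close> into
  \<open>1 / \<kappa>\<close>.\<close>

lemma switch_ratio_candid_less_1:
  assumes "\<sigma> > 0" "lam > 0" "\<kappa> > 0" "first_order_condition \<sigma> lam \<kappa> \<theta>" "0 < \<theta>"
    and "psi \<sigma> lam \<theta> \<le> psi \<sigma> lam 0" "\<theta> < t" "t \<le> 1"
  shows "switch_ratio \<sigma> lam \<kappa> \<theta> t < 1"
proof -
  have th: "lam * scaled_h \<sigma> \<theta> = 1 / \<kappa> - 1"
    using assms by (auto simp: first_order_condition_iff)
  have pos: "1 + lam * scaled_h \<sigma> t > 0"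
    using assms h_nonneg[of \<sigma> t] by (simp add: scaled_h_def add_pos_nonneg)
  have "ln (1 + lam * scaled_h \<sigma> t) + lam * g \<sigma> t < ln (1 / \<kappa>) + lam * g \<sigma> \<theta>"
    using candid_curve_bound[of \<sigma> lam \<theta> t] assms by (simp add: th)
  moreover have "ln (switch_ratio \<sigma> lam \<kappa> \<theta> t)
      = ln \<kappa> + ln (1 + lam * scaled_h \<sigma> t) + lam * (g \<sigma> t - g \<sigma> \<theta>)"
    using assms pos by (simp add: switch_ratio_candid ln_mult)
  ultimately have "ln (switch_ratio \<sigma> lam \<kappa> \<theta> t) < 0"
    using assms by (simp add: ln_div right_diff_distrib)
  then show ?thesis
    using switch_ratio_pos[of \<sigma> lam \<kappa> \<theta> t] assms by simp
qed

lemma continuous_on_switch_ratio: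
  assumes "0 \<le> \<theta>" "\<theta> \<le> 1"
  shows "continuous_on {0..1} (switch_ratio \<sigma> lam \<kappa> \<theta>)"
  unfolding switch_ratio_def[abs_def] using assms
  by (intro continuous_intros continuous_on_h continuous_on_g
      continuous_on_compose2[OF continuous_on_g]) auto

lemma switch_ratio_at_switch:
  "switch_ratio \<sigma> lam \<kappa> \<theta> \<theta> = \<kappa> * (1 + lam * scaled_h \<sigma> \<theta>)"
  by (simp add: switch_ratio_candid)

text \<open>Letting time tend to \<theta> from both sides forces the quotient there to be 1, which
  is the first-order condition; the inequality at time 0 then compares \<open>psi\<close> at 0 and
  \<theta>. Conversely, concavity of \<open>psi\<close> carries this comparison to all other
  times.\<close>

lemma optimality_switch_iff:
  assumes "\<sigma> > 0" "lam > 0" "0 < \<kappa>" "\<kappa> < 1" "0 < \<theta>" "\<theta> \<le> 1"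
  shows "(\<forall>t\<in>{0..<\<theta>}. 1 \<le> switch_ratio \<sigma> lam \<kappa> \<theta> t) \<and> (\<forall>t\<in>{\<theta><..1}. switch_ratio \<sigma> lam \<kappa> \<theta> t < 1)
    \<longleftrightarrow> first_order_condition \<sigma> lam \<kappa> \<theta> \<and> psi \<sigma> lam \<theta> \<le> psi \<sigma> lam 0" (is "?L \<longleftrightarrow> ?R")
proof
  assume L: ?L
  \<comment> \<open>With no candid phase the co-state vanishes and the quotient starts at
    \<open>\<kappa> < 1\<close>, against the rule at time 0.\<close>
  have "\<theta> < 1"
  proof (rule ccontr)
    assume "\<not> \<theta> < 1"
    with assms have "switch_ratio \<sigma> lam \<kappa> \<theta> 0 = \<kappa>"
      by (simp add: switch_ratio_def)
    with L assms show False by force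
  qed
  have cont: "continuous_on S (switch_ratio \<sigma> lam \<kappa> \<theta>)" if "S \<subseteq> {0..1}" for S
    using continuous_on_switch_ratio[of \<theta> \<sigma> lam \<kappa>] that assms continuous_on_subset by auto
  have "1 \<le> switch_ratio \<sigma> lam \<kappa> \<theta> \<theta>"
    by (rule continuous_ge_on_Ioo[of 0 \<theta> "switch_ratio \<sigma> lam \<kappa> \<theta>", OF cont])
      (use L assms in auto)
  \<comment> \<open>The bound from the right, negated so that the same limit lemma applies.\<close>
  moreover have "- 1 \<le> - switch_ratio \<sigma> lam \<kappa> \<theta> \<theta>"
    by (rule continuous_ge_on_Ioo[of \<theta> 1 "\<lambda>t. - switch_ratio \<sigma> lam \<kappa> \<theta> t",
          OF continuous_on_minus[OF cont]])
      (use L assms \<open>\<theta> < 1\<close> in \<open>auto simp: less_imp_le\<close>)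
  ultimately have "\<kappa> * (1 + lam * scaled_h \<sigma> \<theta>) = 1"
    by (simp add: switch_ratio_at_switch)
  then have foc: "first_order_condition \<sigma> lam \<kappa> \<theta>"
    using assms \<open>\<theta> < 1\<close> by (simp add: first_order_condition_iff field_simps)
  have "1 \<le> switch_ratio \<sigma> lam \<kappa> \<theta> 0"
    using L assms by simp
  then have "0 \<le> (1 - \<kappa>) * (exp (psi \<sigma> lam 0 - psi \<sigma> lam \<theta>) - 1)"
    using assms by (simp add: switch_ratio_sparing foc)
  then have "1 \<le> exp (psi \<sigma> lam 0 - psi \<sigma> lam \<theta>)"
    using assms by (simp add: zero_le_mult_iff)
  with foc show ?R
    by simp
next
  assume R: ?R
  have "1 \<le> switch_ratio \<sigma> lam \<kappa> \<theta> t" if t: "t \<in> {0..<\<theta>}" for t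
  proof -
    have "psi \<sigma> lam \<theta> \<le> psi \<sigma> lam t"
      using psi_greater_before[of \<sigma> lam t \<theta>] R t assms
      by (cases "t = 0") (auto simp: first_order_condition_def)
    then show ?thesis
      using R t assms by (simp add: switch_ratio_sparing)
  qed
  moreover have "switch_ratio \<sigma> lam \<kappa> \<theta> t < 1" if "t \<in> {\<theta><..1}" for t
    using that R assms by (intro switch_ratio_candid_less_1) auto
  ultimately show ?L by blast
qed

text \<open>State and co-state are the explicit ones by uniqueness, and \<theta> is the only
  discontinuity, so the rule becomes a pair of inequalities for \<open>switch_ratio\<close> at all
  times other than \<theta>.\<close>

lemma is_equilibrium_switch_iff:
  assumes "\<sigma> > 0" "lam > 0" "\<beta> > 0" "0 < \<kappa>" "\<kappa> < 1" "0 < \<theta>" "\<theta> \<le> 1"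
    and ctrl: "is_control \<pi>" "sparing_then_candid \<pi> \<theta>"
    and state: "is_state \<sigma> lam \<pi> \<gamma>" and costate: "is_costate \<sigma> lam \<beta> \<kappa> \<pi> \<mu>"
  shows "is_equilibrium \<sigma> lam \<beta> \<kappa> \<pi> \<gamma> \<mu> \<longleftrightarrow>
    first_order_condition \<sigma> lam \<kappa> \<theta> \<and> psi \<sigma> lam \<theta> \<le> psi \<sigma> lam 0"
proof -
  have cp: "continuity_point \<pi> t \<longleftrightarrow> t \<in> {0..<\<theta>} \<union> {\<theta><..1}" for t
    using continuity_point_sparing_then_candid[OF ctrl(2), of t]
      not_continuity_point_switch[OF ctrl(2)] assms by (cases "t = \<theta>") auto
  have compare: "switching_curve \<sigma> lam \<beta> \<kappa> \<mu> t \<le> \<gamma> t \<longleftrightarrow> 1 \<le> switch_ratio \<sigma> lam \<kappa> \<theta> t"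
    if "t \<in> {0..1}" for t
    using state_eq_switch_state[OF state ctrl(2) _ that]
      costate_eq_switch_costate[OF costate ctrl(2) _ that] that assms
    by (intro switching_curve_compare) auto
  have "is_equilibrium \<sigma> lam \<beta> \<kappa> \<pi> \<gamma> \<mu> \<longleftrightarrow>
      (\<forall>t\<in>{0..<\<theta>} \<union> {\<theta><..1}. (switching_curve \<sigma> lam \<beta> \<kappa> \<mu> t \<le> \<gamma> t \<longrightarrow> \<pi> t = 1) \<and>
        (\<gamma> t < switching_curve \<sigma> lam \<beta> \<kappa> \<mu> t \<longrightarrow> \<pi> t = 0))"
    unfolding is_equilibrium_def cp using ctrl state costate by blast
  \<comment> \<open>The control takes only the values 0 and 1, which the last conjunct records; this
    merges the two implications of the rule into one equivalence.\<close>
  also have "\<dots> \<longleftrightarrow> (\<forall>t\<in>{0..<\<theta>} \<union> {\<theta><..1}. (1 \<le> switch_ratio \<sigma> lam \<kappa> \<theta> t \<longleftrightarrow> \<pi> t = 1) \<and>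
        (\<pi> t = 0 \<longleftrightarrow> \<pi> t \<noteq> 1))"
  proof (intro ball_cong refl)
    fix t assume t: "t \<in> {0..<\<theta>} \<union> {\<theta><..1}"
    then have "\<pi> t = 0 \<or> \<pi> t = 1" "t \<in> {0..1}"
      using ctrl(2) assms by (auto simp: sparing_then_candid_def)
    with compare[of t]
    show "(switching_curve \<sigma> lam \<beta> \<kappa> \<mu> t \<le> \<gamma> t \<longrightarrow> \<pi> t = 1) \<and>
        (\<gamma> t < switching_curve \<sigma> lam \<beta> \<kappa> \<mu> t \<longrightarrow> \<pi> t = 0) \<longleftrightarrow>
        (1 \<le> switch_ratio \<sigma> lam \<kappa> \<theta> t \<longleftrightarrow> \<pi> t = 1) \<and> (\<pi> t = 0 \<longleftrightarrow> \<pi> t \<noteq> 1)"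
      by auto
  qed
  also have "\<dots> \<longleftrightarrow> (\<forall>t\<in>{0..<\<theta>}. 1 \<le> switch_ratio \<sigma> lam \<kappa> \<theta> t) \<and>
      (\<forall>t\<in>{\<theta><..1}. switch_ratio \<sigma> lam \<kappa> \<theta> t < 1)"
    using ctrl(2) assms by (auto simp: sparing_then_candid_def ball_Un not_le)
  also have "\<dots> \<longleftrightarrow> first_order_condition \<sigma> lam \<kappa> \<theta> \<and> psi \<sigma> lam \<theta> \<le> psi \<sigma> lam 0"
    using assms by (intro optimality_switch_iff)
  finally show ?thesis .
qed

section \<open>Equilibria, switching times and the existence criterion\<close>

lemma switching_equilibriumD:
  assumes "\<sigma> > 0" "lam > 0" "\<beta> > 0" "0 < \<kappa>" "\<kappa> < 1"
    and "switching_equilibrium \<sigma> lam \<beta> \<kappa> \<theta> \<pi> \<gamma> \<mu>"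
  shows "0 < \<theta>" "first_order_condition \<sigma> lam \<kappa> \<theta>" "psi \<sigma> lam \<theta> \<le> psi \<sigma> lam 0"
  using assms is_equilibrium_switch_iff[of \<sigma> lam \<beta> \<kappa> \<theta> \<pi> \<gamma> \<mu>]
  by (auto simp: switching_equilibrium_def is_equilibrium_def)

text \<open>The state meets the curve where the quotient is 1. After \<theta> the quotient is
  smaller, and strictly between 0 and \<theta> it is larger, so only time 0 can be a second meeting
  point; it is one exactly when \<open>psi\<close> agrees at 0 and \<theta>.\<close>

lemma switching_times_eq_singleton_iff:
  assumes "\<sigma> > 0" "lam > 0" "\<beta> > 0" "0 < \<kappa>" "\<kappa> < 1"
    and eq: "switching_equilibrium \<sigma> lam \<beta> \<kappa> \<theta> \<pi> \<gamma> \<mu>"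
  shows "switching_times \<sigma> lam \<beta> \<kappa> \<gamma> \<mu> = {\<theta>} \<longleftrightarrow> psi \<sigma> lam \<theta> < psi \<sigma> lam 0"
proof -
  note D = switching_equilibriumD[OF assms]
  have th: "\<theta> < 1"
    using D by (simp add: first_order_condition_def)
  have "\<gamma> t = switching_curve \<sigma> lam \<beta> \<kappa> \<mu> t \<longleftrightarrow> switch_ratio \<sigma> lam \<kappa> \<theta> t = 1" if "t \<in> {0..1}" for t
    using state_eq_switch_state[of \<sigma> lam \<pi> \<gamma> \<theta> t] costate_eq_switch_costate[of \<sigma> lam \<beta> \<kappa> \<pi> \<mu> \<theta> t]
      that assms by (intro switching_curve_compare) (auto simp: switching_equilibrium_def is_equilibrium_def)
  then have "switching_times \<sigma> lam \<beta> \<kappa> \<gamma> \<mu> = {t \<in> {0..1}. switch_ratio \<sigma> lam \<kappa> \<theta> t = 1}"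
    unfolding switching_times_def by blast
  also have "\<dots> = {t \<in> {0..\<theta>}. psi \<sigma> lam t = psi \<sigma> lam \<theta>}"
  proof -
    have "switch_ratio \<sigma> lam \<kappa> \<theta> t \<noteq> 1" if "\<theta> < t" "t \<le> 1" for t
      using switch_ratio_candid_less_1[of \<sigma> lam \<kappa> \<theta> t] that D assms by auto
    moreover have "switch_ratio \<sigma> lam \<kappa> \<theta> t = 1 \<longleftrightarrow> psi \<sigma> lam t = psi \<sigma> lam \<theta>" if "t \<le> \<theta>" for t
      using switch_ratio_sparing[OF assms(1,2,4) D(2) that] assms(5) by simp
    ultimately have "t \<in> {0..1} \<and> switch_ratio \<sigma> lam \<kappa> \<theta> t = 1 \<longleftrightarrow>
        t \<in> {0..\<theta>} \<and> psi \<sigma> lam t = psi \<sigma> lam \<theta>" for t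
      using th by (cases "t \<le> \<theta>") auto
    then show ?thesis
      by blast
  qed
  also have "\<dots> = {\<theta>} \<longleftrightarrow> psi \<sigma> lam 0 \<noteq> psi \<sigma> lam \<theta>"
  proof -
    have "psi \<sigma> lam t \<noteq> psi \<sigma> lam \<theta>" if "0 < t" "t < \<theta>" for t
      using psi_greater_before[of \<sigma> lam t \<theta>] that th D assms by auto
    then have "t \<in> {0..\<theta>} \<and> psi \<sigma> lam t = psi \<sigma> lam \<theta> \<longleftrightarrow>
        t = \<theta> \<or> t = 0 \<and> psi \<sigma> lam 0 = psi \<sigma> lam \<theta>" for t
      using D(1) by (cases "t = 0 \<or> t = \<theta>") auto
    then have "{t \<in> {0..\<theta>}. psi \<sigma> lam t = psi \<sigma> lam \<theta>} =
        {t. t = \<theta> \<or> t = 0 \<and> psi \<sigma> lam 0 = psi \<sigma> lam \<theta>}"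
      by blast
    then show ?thesis
      using D(1) by (auto simp: set_eq_iff)
  qed
  finally show ?thesis
    using D(3) by auto
qed

lemma switching_equilibrium_exists:
  assumes "\<sigma> > 0" "lam > 0" "\<beta> > 0" "0 < \<kappa>" "\<kappa> < 1"
    and "0 < \<theta>" "first_order_condition \<sigma> lam \<kappa> \<theta>" "psi \<sigma> lam \<theta> \<le> psi \<sigma> lam 0"
  shows "switching_equilibrium \<sigma> lam \<beta> \<kappa> \<theta> (switch_control \<theta>) (switch_state \<sigma> lam \<theta>)
    (switch_costate \<sigma> lam \<beta> \<kappa> \<theta>)"
proof -
  have "\<theta> < 1"
    using assms by (simp add: first_order_condition_def)
  then show ?thesis
    using assms sparing_then_candid_switch_control is_control_switch_control
      is_state_switch_state is_costate_switch_costate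
    by (simp add: switching_equilibrium_def is_equilibrium_switch_iff)
qed

text \<open>Multiplying \<open>Q > lam\<close> by \<open>g \<sigma> \<theta>\<close> gives the
  comparison of \<open>psi\<close> at \<theta> and 0, as \<open>g \<sigma> 0 = 0\<close>.
  Multiplying it by \<open>scaled_h \<sigma> \<theta>\<close> instead turns \<open>lam\<close> into
  \<open>1 / k - 1\<close> by the first-order condition.\<close>

lemma existence_criteria:
  assumes "\<sigma> > 0" "lam > 0" "first_order_condition \<sigma> lam k \<theta>"
  defines "Q \<equiv> - ln (h \<sigma> \<theta> / h \<sigma> 0) / g \<sigma> \<theta>"
  shows "Q > lam \<longleftrightarrow> 0 < \<theta> \<and> psi \<sigma> lam \<theta> < psi \<sigma> lam 0"
    and "Q \<ge> lam \<longleftrightarrow> 0 < \<theta> \<and> psi \<sigma> lam \<theta> \<le> psi \<sigma> lam 0"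
    and "(1 - \<theta>) * h \<sigma> \<theta> * Q > 1 / k - 1 \<longleftrightarrow> Q > lam"
    and "(1 - \<theta>) * h \<sigma> \<theta> * Q \<ge> 1 / k - 1 \<longleftrightarrow> Q \<ge> lam"
proof -
  have th: "0 \<le> \<theta>" "\<theta> < 1" and eq: "1 / k - 1 = scaled_h \<sigma> \<theta> * lam"
    using assms by (auto simp: first_order_condition_iff)
  have s: "scaled_h \<sigma> \<theta> > 0"
    using th assms by (simp add: scaled_h_pos)
  show "(1 - \<theta>) * h \<sigma> \<theta> * Q > 1 / k - 1 \<longleftrightarrow> Q > lam"
    "(1 - \<theta>) * h \<sigma> \<theta> * Q \<ge> 1 / k - 1 \<longleftrightarrow> Q \<ge> lam"
    using s by (simp_all add: eq flip: scaled_h_def)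
  have pos: "h \<sigma> \<theta> > 0" "h \<sigma> 0 > 0"
    using th assms by (auto intro: h_pos)
  have "(Q > lam \<longleftrightarrow> 0 < \<theta> \<and> psi \<sigma> lam \<theta> < psi \<sigma> lam 0) \<and>
      (Q \<ge> lam \<longleftrightarrow> 0 < \<theta> \<and> psi \<sigma> lam \<theta> \<le> psi \<sigma> lam 0)"
  proof (cases "\<theta> = 0")
    \<comment> \<open>Here \<open>g \<sigma> \<theta> = 0\<close>, and division by zero makes
      \<open>Q = 0 < lam\<close>; so both comparisons with \<open>lam\<close> fail.\<close>
    case True
    then show ?thesis
      using assms by (simp add: g_0 Q_def)
  next
    case False
    then have "g \<sigma> \<theta> > 0"
      using th assms by (intro g_pos) auto
    then show ?thesis
      using False th pos
      by (auto simp: Q_def psi_def g_0 ln_div pos_less_divide_eq pos_le_divide_eq)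
  qed
  then show "Q > lam \<longleftrightarrow> 0 < \<theta> \<and> psi \<sigma> lam \<theta> < psi \<sigma> lam 0"
    "Q \<ge> lam \<longleftrightarrow> 0 < \<theta> \<and> psi \<sigma> lam \<theta> \<le> psi \<sigma> lam 0"
    by auto
qed

section \<open>The payoff as a function of the switching time\<close>

text \<open>The objective for a switch at \<open>s\<close>, with the state frozen at
  \<open>gamma1 \<sigma> lam s\<close>. The integral from \<open>s\<close> to 1 is written as a
  difference, so that \<open>s\<close> is an upper limit and can be differentiated.\<close>

definition switch_payoff :: "real \<Rightarrow> real \<Rightarrow> real \<Rightarrow> real \<Rightarrow> real \<Rightarrow> real" where
  "switch_payoff \<sigma> lam \<beta> \<kappa> s =
     \<beta> * (integral {0..1} (gamma1 \<sigma> lam) - integral {0..s} (gamma1 \<sigma> lam)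
       - \<kappa> * (1 - s) * gamma1 \<sigma> lam s)"

lemma continuous_on_gamma1: "continuous_on {0..1} (gamma1 \<sigma> lam)"
  unfolding gamma1_def[abs_def] by (intro continuous_intros continuous_on_g)

lemma objective_eq_switch_payoff:
  assumes state: "is_state \<sigma> lam \<pi> \<gamma>" and ctrl: "sparing_then_candid \<pi> s" and s: "s \<in> {0..1}"
  shows "objective \<sigma> lam \<beta> \<kappa> \<pi> \<gamma> = switch_payoff \<sigma> lam \<beta> \<kappa> s"
proof -
  have int: "gamma1 \<sigma> lam integrable_on {0..1}" "gamma1 \<sigma> lam integrable_on {s..1}"
    using s by (auto intro!: integrable_continuous_real continuous_on_subset[OF continuous_on_gamma1])
  have "objective \<sigma> lam \<beta> \<kappa> \<pi> \<gamma> = integral {0..1}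
      (\<lambda>t. if t \<in> {s..1} then \<beta> * (gamma1 \<sigma> lam t - \<kappa> * gamma1 \<sigma> lam s) else 0)"
    unfolding objective_def
  proof (rule integral_cong)
    fix t :: real assume t: "t \<in> {0..1}"
    have "\<gamma> t = gamma1 \<sigma> lam s" if "s \<le> t"
      using state_eq_switch_state[OF state ctrl s t] that
      by (simp add: switch_state_def gamma1_def min_absorb2)
    then show "(1 - \<pi> t) * \<beta> * (gamma1 \<sigma> lam t - \<kappa> * \<gamma> t) =
        (if t \<in> {s..1} then \<beta> * (gamma1 \<sigma> lam t - \<kappa> * gamma1 \<sigma> lam s) else 0)"
      using t ctrl by (auto simp: sparing_then_candid_def)
  qed
  also have "\<dots> = integral {s..1} (\<lambda>t. \<beta> * (gamma1 \<sigma> lam t - \<kappa> * gamma1 \<sigma> lam s))"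
    using s by (subst integral_restrict_Int) (simp add: Int_absorb1)
  also have "\<dots> = \<beta> * (integral {s..1} (gamma1 \<sigma> lam) - \<kappa> * gamma1 \<sigma> lam s * (1 - s))"
    using s int(2) by (simp add: Henstock_Kurzweil_Integration.integral_diff[OF int(2) integrable_const_ivl])
  also have "integral {s..1} (gamma1 \<sigma> lam) = integral {0..1} (gamma1 \<sigma> lam) - integral {0..s} (gamma1 \<sigma> lam)"
    using Henstock_Kurzweil_Integration.integral_combine[of 0 s 1 "gamma1 \<sigma> lam"] s int by simp
  finally show ?thesis
    by (simp add: switch_payoff_def mult_ac)
qed

lemma continuous_on_switch_payoff: "continuous_on {0..1} (switch_payoff \<sigma> lam \<beta> \<kappa>)"
  unfolding switch_payoff_def[abs_def]
  by (intro continuous_intros continuous_on_gamma1 indefinite_integral_continuous_1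
      integrable_continuous_real)

lemma switch_payoff_has_derivative:
  assumes "0 < s" "s < 1"
  shows "(switch_payoff \<sigma> lam \<beta> \<kappa> has_real_derivative
    \<beta> * gamma1 \<sigma> lam s * (\<kappa> * (1 + lam * scaled_h \<sigma> s) - 1)) (at s)"
proof -
  have "((\<lambda>s. integral {0..s} (gamma1 \<sigma> lam)) has_real_derivative gamma1 \<sigma> lam s) (at s within {0..1})"
    using assms by (intro integral_has_real_derivative continuous_on_gamma1) auto
  then have int: "((\<lambda>s. integral {0..s} (gamma1 \<sigma> lam)) has_real_derivative gamma1 \<sigma> lam s) (at s)"
    using assms by (simp add: at_within_Icc_at)
  have gam: "(gamma1 \<sigma> lam has_real_derivative - lam * h \<sigma> s * gamma1 \<sigma> lam s) (at s)"
    unfolding gamma1_def[abs_def]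
    using assms by (auto intro!: derivative_eq_intros g_has_derivative)
  show ?thesis
    unfolding switch_payoff_def[abs_def]
    by (rule derivative_eq_intros int gam refl | simp add: scaled_h_def algebra_simps)+
qed

text \<open>The bracket in the derivative vanishes at \<theta> by the first-order condition. As
  \<open>scaled_h\<close> is strictly decreasing, it is positive before \<theta> and negative
  after.\<close>

lemma switch_payoff_strict_max:
  assumes "\<sigma> > 0" "lam > 0" "\<beta> > 0" "0 < \<kappa>" "first_order_condition \<sigma> lam \<kappa> \<theta>"
    and s: "s \<in> {0..1}" "s \<noteq> \<theta>"
  shows "switch_payoff \<sigma> lam \<beta> \<kappa> s < switch_payoff \<sigma> lam \<beta> \<kappa> \<theta>"
proof -
  have th: "0 \<le> \<theta>" "\<theta> < 1" "lam * scaled_h \<sigma> \<theta> = 1 / \<kappa> - 1"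
    using assms by (auto simp: first_order_condition_iff)
  have at: "\<kappa> * (1 + lam * scaled_h \<sigma> \<theta>) = 1"
    using assms by (simp add: th field_simps)
  have gam: "\<beta> * gamma1 \<sigma> lam x > 0" for x
    using assms by (simp add: gamma1_def)
  have cont: "continuous_on S (switch_payoff \<sigma> lam \<beta> \<kappa>)" if "S \<subseteq> {0..1}" for S
    using continuous_on_subset[OF continuous_on_switch_payoff that] .
  consider "s < \<theta>" | "\<theta> < s" using s by linarith
  then show ?thesis
  proof cases
    case 1
    show ?thesis
    proof (rule DERIV_pos_imp_increasing_open[OF 1])
      fix x assume x: "s < x" "x < \<theta>"
      have "\<kappa> * (1 + lam * scaled_h \<sigma> \<theta>) < \<kappa> * (1 + lam * scaled_h \<sigma> x)"
        using scaled_h_strict_antimono[of \<sigma> x \<theta>] assms(1,2,4) x th(2) by simp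
      then have "\<beta> * gamma1 \<sigma> lam x * (\<kappa> * (1 + lam * scaled_h \<sigma> x) - 1) > 0"
        using gam[of x] by (simp only: at mult_pos_pos diff_gt_0_iff_gt)
      then show "\<exists>y. (switch_payoff \<sigma> lam \<beta> \<kappa> has_real_derivative y) (at x) \<and> 0 < y"
        using switch_payoff_has_derivative[of x \<sigma> lam \<beta> \<kappa>] x s th by fastforce
    qed (use s th in \<open>auto intro!: cont\<close>)
  next
    case 2
    show ?thesis
    proof (rule DERIV_neg_imp_decreasing_open[OF 2])
      fix x assume x: "\<theta> < x" "x < s"
      have "\<kappa> * (1 + lam * scaled_h \<sigma> x) < \<kappa> * (1 + lam * scaled_h \<sigma> \<theta>)"
        using scaled_h_strict_antimono[of \<sigma> \<theta> x] assms(1,2,4) x s by simp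
      then have "\<beta> * gamma1 \<sigma> lam x * (\<kappa> * (1 + lam * scaled_h \<sigma> x) - 1) < 0"
        using gam[of x] by (simp only: at mult_pos_neg diff_less_0_iff_less)
      then show "\<exists>y. (switch_payoff \<sigma> lam \<beta> \<kappa> has_real_derivative y) (at x) \<and> y < 0"
        using switch_payoff_has_derivative[of x \<sigma> lam \<beta> \<kappa>] x s th by fastforce
    qed (use s th in \<open>auto intro!: cont\<close>)
  qed
qed

section \<open>Assembly of location, existence and dependence on \<open>lam\<close>\<close>

theorem mainTheorem3:
  fixes \<sigma> lam \<alpha> \<beta> \<kappa> :: real
  assumes "\<sigma> > 0" and "lam > 0" and "0 < \<alpha>" and "\<alpha> < \<beta>"
    and "\<kappa> = 1 - \<alpha> / \<beta>" and "0 < \<kappa>" and "\<kappa> < 1"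
  shows "
     \<comment> \<open>(1) location\<close>
     ((\<forall>\<theta> \<pi> \<gamma> \<mu>. switching_equilibrium \<sigma> lam \<beta> \<kappa> \<theta> \<pi> \<gamma> \<mu> \<longrightarrow>
        first_order_condition \<sigma> lam \<kappa> \<theta> \<and>
        (\<forall>s \<pi>' \<gamma>'. s \<in> {0..1} \<and> s \<noteq> \<theta> \<and> is_control \<pi>' \<and> sparing_then_candid \<pi>' s \<and>
             is_state \<sigma> lam \<pi>' \<gamma>' \<longrightarrow>
           objective \<sigma> lam \<beta> \<kappa> \<pi>' \<gamma>' < objective \<sigma> lam \<beta> \<kappa> \<pi> \<gamma>))
     \<and> (\<forall>\<theta>. first_order_condition \<sigma> lam \<kappa> \<theta> \<longleftrightarrow>
          0 \<le> \<theta> \<and> \<theta> < 1 \<and> (1 - \<theta>) * h \<sigma> \<theta> = (1 / \<kappa> - 1) / lam)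
     \<and> (\<forall>k>0. (\<exists>\<theta>. first_order_condition \<sigma> lam k \<theta>) \<longleftrightarrow> 1 > k \<and> k \<ge> 1 / (1 + lam * h \<sigma> 0))
     \<and> (\<forall>\<theta> \<theta>'. first_order_condition \<sigma> lam \<kappa> \<theta> \<and> first_order_condition \<sigma> lam \<kappa> \<theta>' \<longrightarrow> \<theta> = \<theta>'))
     \<and>
     \<comment> \<open>(2) existence, with \<open>\<theta>\<close> the only time at which the state meets the switching curve\<close>
     ((\<exists>\<theta> \<pi> \<gamma> \<mu>. switching_equilibrium \<sigma> lam \<beta> \<kappa> \<theta> \<pi> \<gamma> \<mu> \<and>
        switching_times \<sigma> lam \<beta> \<kappa> \<gamma> \<mu> = {\<theta>}) \<longleftrightarrow>
     (\<exists>\<theta>. first_order_condition \<sigma> lam \<kappa> \<theta> \<and>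
        (1 - \<theta>) * h \<sigma> \<theta> * (- ln (h \<sigma> \<theta> / h \<sigma> 0) / g \<sigma> \<theta>) > 1 / \<kappa> - 1 \<and>
        - ln (h \<sigma> \<theta> / h \<sigma> 0) / g \<sigma> \<theta> > lam))
     \<and>
     \<comment> \<open>(2) existence, when the state may also meet the switching curve elsewhere\<close>
     ((\<exists>\<theta> \<pi> \<gamma> \<mu>. switching_equilibrium \<sigma> lam \<beta> \<kappa> \<theta> \<pi> \<gamma> \<mu>) \<longleftrightarrow>
     (\<exists>\<theta>. first_order_condition \<sigma> lam \<kappa> \<theta> \<and>
        (1 - \<theta>) * h \<sigma> \<theta> * (- ln (h \<sigma> \<theta> / h \<sigma> 0) / g \<sigma> \<theta>) \<ge> 1 / \<kappa> - 1 \<and>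
        - ln (h \<sigma> \<theta> / h \<sigma> 0) / g \<sigma> \<theta> \<ge> lam))
     \<and>
     \<comment> \<open>(3) dependence on \<open>lam\<close>\<close>
     (\<forall>\<theta> \<pi> \<gamma> \<mu>. switching_equilibrium \<sigma> lam \<beta> \<kappa> \<theta> \<pi> \<gamma> \<mu> \<longrightarrow>
       \<theta> = switching_time \<sigma> \<kappa> lam \<and>
       (switching_time \<sigma> \<kappa> has_real_derivative
          (1 - \<theta>) * h \<sigma> \<theta> / (lam * (h \<sigma> \<theta> - (1 - \<theta>) * deriv (h \<sigma>) \<theta>))) (at lam) \<and>
       (1 - \<theta>) * h \<sigma> \<theta> / (lam * (h \<sigma> \<theta> - (1 - \<theta>) * deriv (h \<sigma>) \<theta>)) > 0)"
proof -
  have \<beta>: "\<beta> > 0"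
    using assms(3,4) by simp
  note eqD = switching_equilibriumD[OF assms(1,2) \<beta> assms(6,7)]
  have "objective \<sigma> lam \<beta> \<kappa> \<pi>' \<gamma>' < objective \<sigma> lam \<beta> \<kappa> \<pi> \<gamma>"
    if eq: "switching_equilibrium \<sigma> lam \<beta> \<kappa> \<theta> \<pi> \<gamma> \<mu>"
      and s: "s \<in> {0..1}" "s \<noteq> \<theta>" and "sparing_then_candid \<pi>' s" "is_state \<sigma> lam \<pi>' \<gamma>'"
    for \<theta> \<pi> \<gamma> \<mu> s \<pi>' \<gamma>'
  proof -
    have "objective \<sigma> lam \<beta> \<kappa> \<pi> \<gamma> = switch_payoff \<sigma> lam \<beta> \<kappa> \<theta>"
      using eq
      by (intro objective_eq_switch_payoff) (auto simp: switching_equilibrium_def is_equilibrium_def)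
    moreover have "objective \<sigma> lam \<beta> \<kappa> \<pi>' \<gamma>' = switch_payoff \<sigma> lam \<beta> \<kappa> s"
      using that by (intro objective_eq_switch_payoff) auto
    ultimately show ?thesis
      using switch_payoff_strict_max[OF assms(1,2) \<beta> assms(6) eqD(2)[OF eq] s] by simp
  qed
  then have location: "\<forall>\<theta> \<pi> \<gamma> \<mu>. switching_equilibrium \<sigma> lam \<beta> \<kappa> \<theta> \<pi> \<gamma> \<mu> \<longrightarrow>
      first_order_condition \<sigma> lam \<kappa> \<theta> \<and>
      (\<forall>s \<pi>' \<gamma>'. s \<in> {0..1} \<and> s \<noteq> \<theta> \<and> is_control \<pi>' \<and> sparing_then_candid \<pi>' s \<and>
           is_state \<sigma> lam \<pi>' \<gamma>' \<longrightarrow>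
         objective \<sigma> lam \<beta> \<kappa> \<pi>' \<gamma>' < objective \<sigma> lam \<beta> \<kappa> \<pi> \<gamma>)"
    using eqD(2) by blast
  have eq_form: "\<forall>\<theta>. first_order_condition \<sigma> lam \<kappa> \<theta> \<longleftrightarrow>
      0 \<le> \<theta> \<and> \<theta> < 1 \<and> (1 - \<theta>) * h \<sigma> \<theta> = (1 / \<kappa> - 1) / lam"
    using first_order_condition_iff[OF assms(1,2)] by (simp add: scaled_h_def)
  have solvable: "\<forall>k>0. (\<exists>\<theta>. first_order_condition \<sigma> lam k \<theta>) \<longleftrightarrow> 1 > k \<and> k \<ge> 1 / (1 + lam * h \<sigma> 0)"
    using first_order_condition_solvable_iff[OF assms(1,2)] by blast
  have unique: "\<forall>\<theta> \<theta>'. first_order_condition \<sigma> lam \<kappa> \<theta> \<and> first_order_condition \<sigma> lam \<kappa> \<theta>' \<longrightarrow> \<theta> = \<theta>'"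
    using first_order_condition_unique[OF assms(1,2)] by blast
  note exist = switching_equilibrium_exists[OF assms(1,2) \<beta> assms(6,7)]
  note crit = existence_criteria[OF assms(1,2), of \<kappa>]
  have strict: "(\<exists>\<theta> \<pi> \<gamma> \<mu>. switching_equilibrium \<sigma> lam \<beta> \<kappa> \<theta> \<pi> \<gamma> \<mu> \<and>
        switching_times \<sigma> lam \<beta> \<kappa> \<gamma> \<mu> = {\<theta>}) \<longleftrightarrow>
      (\<exists>\<theta>. first_order_condition \<sigma> lam \<kappa> \<theta> \<and>
        (1 - \<theta>) * h \<sigma> \<theta> * (- ln (h \<sigma> \<theta> / h \<sigma> 0) / g \<sigma> \<theta>) > 1 / \<kappa> - 1 \<and>
        - ln (h \<sigma> \<theta> / h \<sigma> 0) / g \<sigma> \<theta> > lam)"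
  proof -
    note single = switching_times_eq_singleton_iff[OF assms(1,2) \<beta> assms(6,7)]
    \<comment> \<open>From right to left the witnesses are the explicit control, state and co-state;
      strictness of the comparison then rules out a second meeting point at time 0.\<close>
    have "(\<exists>\<theta> \<pi> \<gamma> \<mu>. switching_equilibrium \<sigma> lam \<beta> \<kappa> \<theta> \<pi> \<gamma> \<mu> \<and>
          switching_times \<sigma> lam \<beta> \<kappa> \<gamma> \<mu> = {\<theta>}) \<longleftrightarrow>
        (\<exists>\<theta>. first_order_condition \<sigma> lam \<kappa> \<theta> \<and> 0 < \<theta> \<and> psi \<sigma> lam \<theta> < psi \<sigma> lam 0)"
      using single eqD exist less_imp_le by meson
    also have "\<dots> \<longleftrightarrow> (\<exists>\<theta>. first_order_condition \<sigma> lam \<kappa> \<theta> \<and>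
        (1 - \<theta>) * h \<sigma> \<theta> * (- ln (h \<sigma> \<theta> / h \<sigma> 0) / g \<sigma> \<theta>) > 1 / \<kappa> - 1 \<and>
        - ln (h \<sigma> \<theta> / h \<sigma> 0) / g \<sigma> \<theta> > lam)"
      using crit(1,3) by blast
    finally show ?thesis .
  qed
  have weak: "(\<exists>\<theta> \<pi> \<gamma> \<mu>. switching_equilibrium \<sigma> lam \<beta> \<kappa> \<theta> \<pi> \<gamma> \<mu>) \<longleftrightarrow>
      (\<exists>\<theta>. first_order_condition \<sigma> lam \<kappa> \<theta> \<and>
        (1 - \<theta>) * h \<sigma> \<theta> * (- ln (h \<sigma> \<theta> / h \<sigma> 0) / g \<sigma> \<theta>) \<ge> 1 / \<kappa> - 1 \<and>
        - ln (h \<sigma> \<theta> / h \<sigma> 0) / g \<sigma> \<theta> \<ge> lam)"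
  proof -
    have "(\<exists>\<theta> \<pi> \<gamma> \<mu>. switching_equilibrium \<sigma> lam \<beta> \<kappa> \<theta> \<pi> \<gamma> \<mu>) \<longleftrightarrow>
        (\<exists>\<theta>. first_order_condition \<sigma> lam \<kappa> \<theta> \<and> 0 < \<theta> \<and> psi \<sigma> lam \<theta> \<le> psi \<sigma> lam 0)"
      using eqD exist by meson
    also have "\<dots> \<longleftrightarrow> (\<exists>\<theta>. first_order_condition \<sigma> lam \<kappa> \<theta> \<and>
        (1 - \<theta>) * h \<sigma> \<theta> * (- ln (h \<sigma> \<theta> / h \<sigma> 0) / g \<sigma> \<theta>) \<ge> 1 / \<kappa> - 1 \<and>
        - ln (h \<sigma> \<theta> / h \<sigma> 0) / g \<sigma> \<theta> \<ge> lam)"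
      using crit(2,4) by blast
    finally show ?thesis .
  qed
  have dependence: "\<forall>\<theta> \<pi> \<gamma> \<mu>. switching_equilibrium \<sigma> lam \<beta> \<kappa> \<theta> \<pi> \<gamma> \<mu> \<longrightarrow>
       \<theta> = switching_time \<sigma> \<kappa> lam \<and>
       (switching_time \<sigma> \<kappa> has_real_derivative
          (1 - \<theta>) * h \<sigma> \<theta> / (lam * (h \<sigma> \<theta> - (1 - \<theta>) * deriv (h \<sigma>) \<theta>))) (at lam) \<and>
       (1 - \<theta>) * h \<sigma> \<theta> / (lam * (h \<sigma> \<theta> - (1 - \<theta>) * deriv (h \<sigma>) \<theta>)) > 0"
    using eqD(1,2) switching_time_eq[OF assms(1,2)]
      switching_time_has_derivative[OF assms(1,2,6,7)] by metis
  show ?thesis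
    by (intro conjI location eq_form solvable unique strict weak dependence)
qed

end
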